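(* Let $A:[0,+\infty)\to M_{n\times n}(\mathbb{R})$, $B:[0,+\infty)\to M_{n\times p}(\mathbb{R})$, $C:[0,+\infty)\to M_{m\times n}(\mathbb{R})$ be measurable and bounded on finite intervals, let $F:[0,+\infty)\to M_{p\times m}(\mathbb{R})$ be measurable, and set $K(t):=B(t)F(t)\in M_{n\times m}(\mathbb{R})$. Suppose that the linear system $\dot x(t)=A(t)x(t)$ admits nonuniform bounded growth on $[0,+\infty)$ with constants $K_0>0$, $a>0$ and $\varepsilon>0$. Suppose that there exist constants $\mathcal{K}>0$, $\mathcal{C}>0$, $\delta>0$, $\gamma>0$ such that for all $z\ge 0$ $$\|K(z)\|\le \mathcal{K}e^{\delta z},\qquad \|C(z)\|\le \mathcal{C}e^{-\gamma z},$$ and that $$\gamma-(\varepsilon+\delta)>0,\qquad -a+\varepsilon+\delta>0 .$$ Then the system $$\dot x(t)=A(t)x(t),\qquad y(t)=C(t)x(t)$$ (the pair $(A,C)$) is nonuniformly completely observable if and only if the system $$\dot x(t)=(A(t)-K(t)C(t))x(t),\qquad y(t)=C(t)x(t)$$ (the pair $(A-KC,C)$) is nonuniformly completely observable.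
   Context: Vectors carry the Euclidean norm and $\|\cdot\|$ on matrices is the induced operator norm. For symmetric matrices, $M\le N$ means $N-M$ is positive semidefinite; $I$ is the identity matrix. For a measurable, locally bounded $A:[0,+\infty)\to M_{n\times n}(\mathbb{R})$, $\Phi_A(t,s)$ ($t,s\ge 0$) denotes the transition matrix of $\dot x(t)=A(t)x(t)$ (solutions satisfy $x(t)=\Phi_A(t,s)x(s)$). Nonuniform bounded growth: the system $\dot x=A(t)x$ admits nonuniform bounded growth on $[0,+\infty)$ with constants $K_0>0$, $a>0$, $\varepsilon>0$ if $$\|\Phi_A(t,\tau)\|\le K_0e^{\varepsilon\tau}e^{a|t-\tau|}\quad\text{for all } t,\tau\ge 0 .$$ Observability Gramian of a pair $(A,C)$, i.e. of the system $\dot x=A(t)x$, $y=C(t)x$: $$M(t_0,t_f)=\int_{t_0}^{t_f}\Phi_A^T(s,t_0)C^T(s)C(s)\Phi_A(s,t_0)\,ds .$$ Nonuniform complete observability (NUCO): the pair $(A,C)$ is nonuniformly completely observable if there exist fixed numbers $\nu_0\ge 0$, $\nu_1\ge 0$ and functions $\vartheta_0,\vartheta_1:[0,+\infty)\to(0,+\infty)$ such that for any $t\ge 0$ there exists $\sigma_0(t)>0$ with $$\vartheta_0(\sigma)e^{-2\nu_0t}I\le M(t,t+\sigma)\le \vartheta_1(\sigma)e^{2\nu_1t}I\quad\text{for every }\sigma\ge\sigma_0(t).$$ *)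

theory Defs
  imports "HOL-Analysis.Analysis"
begin

text \<open>Matrix functions on the half line are total functions on the reals of which only the
  values at nonnegative arguments are used. Measurability is Lebesgue measurability on
  \<open>{0..}\<close>.\<close>

abbreviation op_norm :: "real^'n^'m \<Rightarrow> real" where
  "op_norm M \<equiv> onorm ((*v) M)"

definition meas_on_halfline :: "(real \<Rightarrow> real^'n^'m) \<Rightarrow> bool" where
  "meas_on_halfline A \<longleftrightarrow> A \<in> borel_measurable (lebesgue_on {0..})"

definition locally_bounded :: "(real \<Rightarrow> real^'n^'m) \<Rightarrow> bool" where
  "locally_bounded A \<longleftrightarrow> (\<forall>T\<ge>0. \<exists>b. \<forall>t\<in>{0..T}. op_norm (A t) \<le> b)"

text \<open>As \<open>A\<close> is only measurable, solutions are taken in the sense of Caratheodory: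
  locally absolutely continuous functions satisfying the equation almost everywhere,
  written here as the equivalent integral equation.\<close>

definition lin_ode_solution :: "(real \<Rightarrow> real^'n^'n) \<Rightarrow> (real \<Rightarrow> real^'n) \<Rightarrow> bool" where
  "lin_ode_solution A x \<longleftrightarrow>
     (\<forall>u v. 0 \<le> u \<and> u \<le> v \<longrightarrow>
        (\<lambda>r. A r *v x r) absolutely_integrable_on {u..v} \<and>
        x v - x u = integral {u..v} (\<lambda>r. A r *v x r))"

text \<open>For \<open>t, s \<ge> 0\<close> and \<open>A\<close> measurable and locally bounded, every initial value at time \<open>s\<close>
  extends to exactly one solution on the half line, and the value at time \<open>t\<close> depends linearly
  on it; hence the matrix described below exists and is unique.\<close>

definition transition_matrix :: "(real \<Rightarrow> real^'n^'n) \<Rightarrow> real \<Rightarrow> real \<Rightarrow> real^'n^'n" where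
  "transition_matrix A t s = (THE X. \<forall>x. lin_ode_solution A x \<longrightarrow> x t = X *v x s)"

definition nonuniform_bounded_growth ::
    "(real \<Rightarrow> real^'n^'n) \<Rightarrow> real \<Rightarrow> real \<Rightarrow> real \<Rightarrow> bool" where
  "nonuniform_bounded_growth A K0 a \<epsilon> \<longleftrightarrow>
     K0 > 0 \<and> a > 0 \<and> \<epsilon> > 0 \<and>
     (\<forall>t\<ge>0. \<forall>\<tau>\<ge>0.
        op_norm (transition_matrix A t \<tau>) \<le> K0 * exp (\<epsilon> * \<tau>) * exp (a * \<bar>t - \<tau>\<bar>))"

text \<open>The library order on \<^typ>\<open>real^'n^'n\<close> is entrywise, so the order of symmetric matrices
  is introduced separately.\<close>

definition pos_semidef :: "real^'n^'n \<Rightarrow> bool" where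
  "pos_semidef M \<longleftrightarrow> transpose M = M \<and> (\<forall>x. 0 \<le> x \<bullet> (M *v x))"

definition loewner_le :: "real^'n^'n \<Rightarrow> real^'n^'n \<Rightarrow> bool" where
  "loewner_le M N \<longleftrightarrow> pos_semidef (N - M)"

definition obs_gramian ::
    "(real \<Rightarrow> real^'n^'n) \<Rightarrow> (real \<Rightarrow> real^'n^'m) \<Rightarrow> real \<Rightarrow> real \<Rightarrow> real^'n^'n" where
  "obs_gramian A C t0 tf =
     integral {t0..tf}
       (\<lambda>s. transpose (transition_matrix A s t0) ** transpose (C s) ** C s
              ** transition_matrix A s t0)"

definition NUCO :: "(real \<Rightarrow> real^'n^'n) \<Rightarrow> (real \<Rightarrow> real^'n^'m) \<Rightarrow> bool" where
  "NUCO A C \<longleftrightarrow>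
     (\<exists>\<nu>0 \<nu>1. \<exists>\<theta>0 \<theta>1 :: real \<Rightarrow> real.
        \<nu>0 \<ge> 0 \<and> \<nu>1 \<ge> 0 \<and> (\<forall>\<sigma>\<ge>0. \<theta>0 \<sigma> > 0 \<and> \<theta>1 \<sigma> > 0) \<and>
        (\<forall>t\<ge>0. \<exists>\<sigma>0>0. \<forall>\<sigma>\<ge>\<sigma>0.
           loewner_le ((\<theta>0 \<sigma> * exp (- 2 * \<nu>0 * t)) *\<^sub>R mat 1) (obs_gramian A C t (t + \<sigma>)) \<and>
           loewner_le (obs_gramian A C t (t + \<sigma>)) ((\<theta>1 \<sigma> * exp (2 * \<nu>1 * t)) *\<^sub>R mat 1)))"

end

theory Submission
  imports Defs
begin

text \<open>Let \<open>\<Phi>\<close> and \<open>\<Psi>\<close> be the transition matrices of \<open>A\<close> and \<open>A - K C\<close>. Multiplying the variation of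
  constants formula \<open>\<Psi>(s,t) = \<Phi>(s,t) - \<integral> \<Phi>(s,r) K(r) C(r) \<Psi>(r,t) dr\<close> by \<open>C(s)\<close> shows that the outputs
  \<open>w(s) = |C(s) \<Phi>(s,t) v|\<close> and \<open>z(s) = |C(s) \<Psi>(s,t) v|\<close> are related by a Volterra inequality
  \<open>|w(s) - z(s)| \<le> c \<integral> z\<close>, whose kernel is bounded by a constant because of the growth conditions.
  By Cauchy-Schwarz and Gronwall's inequality the integrals of \<open>w\<^sup>2\<close> and \<open>z\<^sup>2\<close> over \<open>[t, t + \<sigma>]\<close>, which are the
  quadratic forms of the two Gramians, bound each other up to factors depending only on \<open>\<sigma>\<close>. Such
  factors are absorbed by the functions \<open>\<theta>0\<close> and \<open>\<theta>1\<close>.\<close>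

subsection \<open>Bilinear maps and locally bounded functions\<close>

lemma bounded_bilinear_matrix_mult:
  "bounded_bilinear ((**) :: real^'n^'m \<Rightarrow> real^'p^'n \<Rightarrow> real^'p^'m)"
  unfolding bilinear_conv_bounded_bilinear[symmetric] bilinear_def
  by (auto intro!: linearI simp: vec_eq_iff matrix_matrix_mult_def sum_distrib_left algebra_simps sum.distrib)

lemma bounded_bilinear_matrix_vector_mult:
  "bounded_bilinear ((*v) :: real^'n^'m \<Rightarrow> real^'n \<Rightarrow> real^'m)"
  unfolding bilinear_conv_bounded_bilinear[symmetric] bilinear_def
  by (auto intro!: linearI simp: vec_eq_iff matrix_vector_mult_def sum_distrib_left algebra_simps sum.distrib)

lemma bounded_linear_transpose: "bounded_linear (transpose :: real^'n^'m \<Rightarrow> real^'m^'n)"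
  unfolding linear_conv_bounded_linear[symmetric]
  by (auto intro!: linearI simp: vec_eq_iff transpose_def)

text \<open>One regularity class for scalars, vectors and matrices, with the Euclidean norm of the
  type in place of the operator norm. It is closed under bilinear products and linear maps, and its
  members are integrable on every bounded interval of the half line.\<close>

definition loc_bdd_meas :: "(real \<Rightarrow> 'a::euclidean_space) \<Rightarrow> bool" where
  "loc_bdd_meas f \<longleftrightarrow> f \<in> borel_measurable (lebesgue_on {0..}) \<and>
     (\<forall>T\<ge>0. \<exists>b. \<forall>t\<in>{0..T}. norm (f t) \<le> b)"

lemma loc_bdd_meas_bound:
  assumes "loc_bdd_meas f" "0 \<le> T"
  obtains b where "b > 0" "\<And>t. 0 \<le> t \<Longrightarrow> t \<le> T \<Longrightarrow> norm (f t) \<le> b"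
proof -
  obtain b where b: "\<forall>t\<in>{0..T}. norm (f t) \<le> b" using assms unfolding loc_bdd_meas_def by blast
  have "norm (f 0) \<le> b" using b assms by auto
  show thesis by (rule that[of "\<bar>b\<bar> + 1"]) (use b in \<open>force+\<close>)
qed

lemma loc_bdd_meas_cong:
  assumes "loc_bdd_meas f" "\<And>t. 0 \<le> t \<Longrightarrow> f t = g t"
  shows "loc_bdd_meas g"
proof -
  have "g \<in> borel_measurable (lebesgue_on {0..}) \<longleftrightarrow> f \<in> borel_measurable (lebesgue_on {0..})"
    by (rule measurable_cong) (use assms(2) in auto)
  then show ?thesis using assms unfolding loc_bdd_meas_def by auto
qed

lemma loc_bdd_meas_continuous:
  assumes "continuous_on {0..} f"
  shows "loc_bdd_meas f"
  unfolding loc_bdd_meas_def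
proof (intro conjI allI impI)
  show "f \<in> borel_measurable (lebesgue_on {0..})"
    by (rule continuous_imp_measurable_on_sets_lebesgue[OF assms]) auto
next
  fix T :: real assume "0 \<le> T"
  have "compact (f ` {0..T})"
    by (intro compact_continuous_image continuous_on_subset[OF assms]) auto
  then show "\<exists>b. \<forall>t\<in>{0..T}. norm (f t) \<le> b"
    by (meson bounded_iff compact_imp_bounded imageI)
qed

lemma loc_bdd_meas_const: "loc_bdd_meas (\<lambda>_. c)"
  by (rule loc_bdd_meas_continuous) auto

lemma loc_bdd_meas_linear:
  assumes "bounded_linear h" "loc_bdd_meas f"
  shows "loc_bdd_meas (\<lambda>t. h (f t))"
  unfolding loc_bdd_meas_def
proof (intro conjI allI impI)
  show "(\<lambda>t. h (f t)) \<in> borel_measurable (lebesgue_on {0..})"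
    using assms(2) unfolding loc_bdd_meas_def
    by (auto intro!: borel_measurable_continuous_on[where f = h] linear_continuous_on assms(1))
next
  fix T :: real assume "0 \<le> T"
  then obtain b where b: "b > 0" "\<And>t. 0 \<le> t \<Longrightarrow> t \<le> T \<Longrightarrow> norm (f t) \<le> b"
    using loc_bdd_meas_bound[OF assms(2)] by blast
  obtain k where k: "\<And>x. norm (h x) \<le> norm x * k" "k > 0"
    using bounded_linear.pos_bounded[OF assms(1)] by blast
  show "\<exists>b. \<forall>t\<in>{0..T}. norm (h (f t)) \<le> b"
  proof (intro exI ballI)
    fix t assume "t \<in> {0..T}"
    then show "norm (h (f t)) \<le> b * k"
      using order_trans[OF k(1)[of "f t"] mult_right_mono[OF b(2)[of t]]] k by auto
  qed
qed

lemma loc_bdd_meas_bilinear: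
  assumes "bounded_bilinear h" "loc_bdd_meas f" "loc_bdd_meas g"
  shows "loc_bdd_meas (\<lambda>t. h (f t) (g t))"
  unfolding loc_bdd_meas_def
proof (intro conjI allI impI)
  show "(\<lambda>t. h (f t) (g t)) \<in> borel_measurable (lebesgue_on {0..})"
  proof (rule borel_measurable_continuous_Pair[where H = h])
    show "continuous_on UNIV (\<lambda>x. h (fst x) (snd x))"
      by (intro bounded_bilinear.continuous_on[OF assms(1)] continuous_on_fst continuous_on_snd continuous_on_id)
  qed (use assms(2,3) in \<open>auto simp: loc_bdd_meas_def\<close>)
next
  fix T :: real assume T: "0 \<le> T"
  obtain b where b: "b > 0" "\<And>t. 0 \<le> t \<Longrightarrow> t \<le> T \<Longrightarrow> norm (f t) \<le> b"
    using loc_bdd_meas_bound[OF assms(2) T] by blast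
  obtain d where d: "d > 0" "\<And>t. 0 \<le> t \<Longrightarrow> t \<le> T \<Longrightarrow> norm (g t) \<le> d"
    using loc_bdd_meas_bound[OF assms(3) T] by blast
  obtain k where k: "\<And>x y. norm (h x y) \<le> norm x * norm y * k" "k > 0"
    using bounded_bilinear.pos_bounded[OF assms(1)] by blast
  show "\<exists>b. \<forall>t\<in>{0..T}. norm (h (f t) (g t)) \<le> b"
  proof (intro exI ballI)
    fix t assume "t \<in> {0..T}"
    then show "norm (h (f t) (g t)) \<le> b * d * k"
      by (intro order_trans[OF k(1)] mult_right_mono mult_mono b(2) d(2)) (use b(1) k(2) in auto)
  qed
qed

lemma loc_bdd_meas_add:
  assumes "loc_bdd_meas f" "loc_bdd_meas g"
  shows "loc_bdd_meas (\<lambda>t. f t + g t)"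
  unfolding loc_bdd_meas_def
proof (intro conjI allI impI)
  show "(\<lambda>t. f t + g t) \<in> borel_measurable (lebesgue_on {0..})"
    using assms unfolding loc_bdd_meas_def by auto
next
  fix T :: real assume T: "0 \<le> T"
  obtain b where b: "b > 0" "\<And>t. 0 \<le> t \<Longrightarrow> t \<le> T \<Longrightarrow> norm (f t) \<le> b"
    using loc_bdd_meas_bound[OF assms(1) T] by blast
  obtain d where d: "d > 0" "\<And>t. 0 \<le> t \<Longrightarrow> t \<le> T \<Longrightarrow> norm (g t) \<le> d"
    using loc_bdd_meas_bound[OF assms(2) T] by blast
  show "\<exists>b. \<forall>t\<in>{0..T}. norm (f t + g t) \<le> b"
    by (intro exI[of _ "b + d"] ballI norm_triangle_le add_mono) (use b d in auto)
qed

lemma loc_bdd_meas_minus: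
  assumes "loc_bdd_meas f"
  shows "loc_bdd_meas (\<lambda>t. - f t)"
  using loc_bdd_meas_linear[OF bounded_linear_minus[OF bounded_linear_ident] assms] .

lemma loc_bdd_meas_diff:
  assumes "loc_bdd_meas f" "loc_bdd_meas g"
  shows "loc_bdd_meas (\<lambda>t. f t - g t)"
  using loc_bdd_meas_add[OF assms(1) loc_bdd_meas_minus[OF assms(2)]] by simp

lemma loc_bdd_meas_norm:
  assumes "loc_bdd_meas f"
  shows "loc_bdd_meas (\<lambda>t. norm (f t))"
  using assms unfolding loc_bdd_meas_def by auto

lemma loc_bdd_meas_absolutely_integrable:
  assumes "loc_bdd_meas f" "0 \<le> u"
  shows "f absolutely_integrable_on {u..v}"
proof (cases "u \<le> v")
  case True
  obtain b where b: "b > 0" "\<And>t. 0 \<le> t \<Longrightarrow> t \<le> v \<Longrightarrow> norm (f t) \<le> b"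
    using loc_bdd_meas_bound[OF assms(1), of v] assms True by auto
  show ?thesis
  proof (rule measurable_bounded_by_integrable_imp_absolutely_integrable)
    show "f \<in> borel_measurable (lebesgue_on {u..v})"
      by (rule measurable_restrict_mono[of f _ "{0..}"])
        (use assms in \<open>auto simp: loc_bdd_meas_def\<close>)
    show "(\<lambda>_. b) integrable_on {u..v}" by (rule integrable_const_ivl)
    show "norm (f x) \<le> b" if "x \<in> {u..v}" for x using that b assms by auto
  qed auto
next
  case False then show ?thesis by (simp add: absolutely_integrable_on_def)
qed

lemma loc_bdd_meas_integrable:
  assumes "loc_bdd_meas f" "0 \<le> u"
  shows "f integrable_on {u..v}"
  using loc_bdd_meas_absolutely_integrable[OF assms] absolutely_integrable_on_def by blast

subsection \<open>Primitives of locally bounded functions\<close>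

text \<open>Integral form of \<open>f' = g\<close> almost everywhere. Local boundedness of
  \<open>g\<close>, which is more than integrability, makes \<open>f\<close> locally Lipschitz; this
  is what the product rule below rests on.\<close>

definition primitive :: "(real \<Rightarrow> 'a::euclidean_space) \<Rightarrow> (real \<Rightarrow> 'a) \<Rightarrow> bool" where
  "primitive f g \<longleftrightarrow> loc_bdd_meas g \<and> (\<forall>u v. 0 \<le> u \<and> u \<le> v \<longrightarrow> f v - f u = integral {u..v} g)"

lemma primitiveD:
  assumes "primitive f g" "0 \<le> u" "u \<le> v"
  shows "f v - f u = integral {u..v} g"
  using assms unfolding primitive_def by blast

lemma primitive_lipschitz:
  assumes "primitive f g" "0 \<le> T"
  obtains b where "b > 0" "\<And>u v. 0 \<le> u \<Longrightarrow> u \<le> v \<Longrightarrow> v \<le> T \<Longrightarrow> norm (f v - f u) \<le> b * (v - u)"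
proof -
  have g: "loc_bdd_meas g" using assms unfolding primitive_def by blast
  obtain b where b: "b > 0" "\<And>t. 0 \<le> t \<Longrightarrow> t \<le> T \<Longrightarrow> norm (g t) \<le> b"
    using loc_bdd_meas_bound[OF g assms(2)] by blast
  show thesis
  proof (rule that[of b])
    fix u v assume uv: "0 \<le> u" "u \<le> v" "v \<le> T"
    have "norm (integral {u..v} g) \<le> b * (v - u)"
      using integrable_bound[of b g u v] loc_bdd_meas_integrable[OF g, of u v] b uv
      by (auto intro!: order_trans[OF integral_norm_bound_integral[of g "{u..v}" "\<lambda>_. b"]])
    then show "norm (f v - f u) \<le> b * (v - u)" using primitiveD[OF assms(1)] uv by simp
  qed (use b in auto)
qed

lemma continuous_on_halfline:
  fixes f :: "real \<Rightarrow> 'a::real_normed_vector"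
  assumes "\<And>T. 0 < T \<Longrightarrow> continuous_on {0..T} f"
  shows "continuous_on {0..} f"
proof (rule continuous_on_eq_continuous_within[THEN iffD2], rule ballI)
  fix x :: real assume x: "x \<in> {0..}"
  have "continuous (at x within {0..x+1}) f"
    using assms[of "x+1"] x unfolding continuous_on_eq_continuous_within by auto
  moreover have "at x within {0..x+1} = at x within {0..}"
    by (rule at_within_nhd[of _ "{..<x+1}"]) (use x in auto)
  ultimately show "continuous (at x within {0..}) f" by simp
qed

lemma primitive_continuous:
  assumes "primitive f g"
  shows "continuous_on {0..} f"
proof (rule continuous_on_halfline)
  fix T :: real assume "0 < T"
  then obtain b where b: "b > 0" "\<And>u v. 0 \<le> u \<Longrightarrow> u \<le> v \<Longrightarrow> v \<le> T \<Longrightarrow> norm (f v - f u) \<le> b * (v - u)"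
    using primitive_lipschitz[OF assms] by (metis less_imp_le)
  have "norm (f x - f y) \<le> b * norm (x - y)" if "x \<in> {0..T}" "y \<in> {0..T}" for x y
    using b(2)[of x y] b(2)[of y x] that by (cases "x \<le> y") (auto simp: norm_minus_commute)
  then have "b-lipschitz_on {0..T} f"
    using b(1) by (auto intro!: lipschitz_onI simp: dist_norm)
  then show "continuous_on {0..T} f" by (rule lipschitz_on_continuous_on)
qed

lemma primitive_loc_bdd_meas:
  assumes "primitive f g"
  shows "loc_bdd_meas f"
  using loc_bdd_meas_continuous[OF primitive_continuous[OF assms]] .

text \<open>The difference quotient at \<open>x\<close> is at most \<open>c * norm (y - x)\<close>,
  so the derivative vanishes at every point and not only almost everywhere.\<close>

lemma constant_of_quadratic_increments:
  fixes D :: "real \<Rightarrow> 'a::real_normed_vector"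
  assumes "0 \<le> T" and q: "\<And>u v. 0 \<le> u \<Longrightarrow> u \<le> v \<Longrightarrow> v \<le> T \<Longrightarrow> norm (D v - D u) \<le> c * (v - u)\<^sup>2"
  shows "D T = D 0"
proof -
  have "(D has_derivative (\<lambda>h. 0)) (at x within {0..T})" if x: "x \<in> {0..T}" for x
  proof (rule has_derivativeI_sandwich[of 1])
    show "((\<lambda>y. c * norm (y - x)) \<longlongrightarrow> 0) (at x within {0..T})"
      by (auto intro!: tendsto_eq_intros)
    fix y assume y: "y \<in> {0..T}" "y \<noteq> x"
    have "norm (D y - D x) \<le> c * norm (y - x) * norm (y - x)"
      using q[of x y] q[of y x] x y
      by (cases "x \<le> y") (auto simp: norm_minus_commute power2_eq_square mult.assoc)
    then show "norm (D y - D x - 0) / norm (y - x) \<le> c * norm (y - x)"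
      using y by (simp add: pos_divide_le_eq)
  qed auto
  then obtain k where "\<forall>x\<in>{0..T}. D x = k"
    using has_derivative_zero_constant[of "{0..T}" D] by auto
  then show ?thesis using assms(1) by auto
qed

text \<open>On \<open>[u, v]\<close> the increment of \<open>h f g\<close> and the integral of the formal derivative differ by
  \<open>O((v - u)\<^sup>2)\<close> because \<open>f\<close> and \<open>g\<close> are locally Lipschitz, so their difference has zero
  derivative everywhere; this replaces integration by parts for absolutely continuous functions.\<close>

lemma primitive_bilinear:
  assumes h: "bounded_bilinear h" and f: "primitive f f'" and g: "primitive g g'"
  shows "primitive (\<lambda>t. h (f t) (g t)) (\<lambda>t. h (f' t) (g t) + h (f t) (g' t))"
proof -
  interpret h: bounded_bilinear h by (rule h)
  note hb = loc_bdd_meas_bilinear[OF h]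
  have m: "loc_bdd_meas f'" "loc_bdd_meas g'" "loc_bdd_meas f" "loc_bdd_meas g"
    using f g primitive_loc_bdd_meas[OF f] primitive_loc_bdd_meas[OF g] by (simp_all add: primitive_def)
  let ?d = "\<lambda>t. h (f' t) (g t) + h (f t) (g' t)"
  have md: "loc_bdd_meas ?d" by (intro loc_bdd_meas_add hb m)
  define D where "D = (\<lambda>v. h (f v) (g v) - integral {0..v} ?d)"
  have D0: "D T = D 0" if T: "0 \<le> T" for T
  proof -
    obtain bf where bf: "bf > 0" "\<And>t. 0 \<le> t \<Longrightarrow> t \<le> T \<Longrightarrow> norm (f' t) \<le> bf"
      using loc_bdd_meas_bound[OF m(1) T] by blast
    obtain bg where bg: "bg > 0" "\<And>t. 0 \<le> t \<Longrightarrow> t \<le> T \<Longrightarrow> norm (g' t) \<le> bg"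
      using loc_bdd_meas_bound[OF m(2) T] by blast
    obtain lf where lf: "lf > 0" "\<And>u v. 0 \<le> u \<Longrightarrow> u \<le> v \<Longrightarrow> v \<le> T \<Longrightarrow> norm (f v - f u) \<le> lf * (v - u)"
      using primitive_lipschitz[OF f T] by blast
    obtain lg where lg: "lg > 0" "\<And>u v. 0 \<le> u \<Longrightarrow> u \<le> v \<Longrightarrow> v \<le> T \<Longrightarrow> norm (g v - g u) \<le> lg * (v - u)"
      using primitive_lipschitz[OF g T] by blast
    obtain k where k: "\<And>x y. norm (h x y) \<le> norm x * norm y * k" "k > 0"
      using h.pos_bounded by blast
    let ?c = "bf * lg * k + lf * bg * k"
    show ?thesis
    proof (rule constant_of_quadratic_increments[OF T, of D ?c])
      fix u v assume uv: "0 \<le> u" "u \<le> v" "v \<le> T"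
      \<comment> \<open>What remains of \<open>h (f' r) (g v) + h (f u) (g' r)\<close> after
        subtracting the formal derivative. Each term pairs a bounded derivative with a Lipschitz
        increment, so it is of order \<open>v - u\<close> pointwise and of order
        \<open>(v - u)^2\<close> after integration.\<close>
      let ?e = "\<lambda>r. h (f' r) (g v - g r) - h (f r - f u) (g' r)"
      have i1: "(\<lambda>r. h (f' r) (g v)) integrable_on {u..v}"
        by (intro loc_bdd_meas_integrable hb m loc_bdd_meas_const uv)
      have i2: "(\<lambda>r. h (f u) (g' r)) integrable_on {u..v}"
        by (intro loc_bdd_meas_integrable hb m loc_bdd_meas_const uv)
      have i3: "?d integrable_on {u..v}" by (intro loc_bdd_meas_integrable md uv)
      have i4: "?e integrable_on {u..v}"
        by (intro loc_bdd_meas_integrable loc_bdd_meas_diff hb m loc_bdd_meas_const uv)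
      \<comment> \<open>The increment is split with the values \<open>g v\<close> and
        \<open>f u\<close> frozen, so that they can be moved under the integrals of
        \<open>f'\<close> and \<open>g'\<close>.\<close>
      have "h (f v) (g v) - h (f u) (g u) = h (f v - f u) (g v) + h (f u) (g v - g u)"
        by (simp add: h.diff_left h.diff_right)
      also have "h (f v - f u) (g v) = integral {u..v} (\<lambda>r. h (f' r) (g v))"
        using primitiveD[OF f uv(1,2)] integral_linear[OF loc_bdd_meas_integrable[OF m(1) uv(1)] h.bounded_linear_left, of v "g v"]
        by (simp add: o_def)
      also have "h (f u) (g v - g u) = integral {u..v} (\<lambda>r. h (f u) (g' r))"
        using primitiveD[OF g uv(1,2)] integral_linear[OF loc_bdd_meas_integrable[OF m(2) uv(1)] h.bounded_linear_right, of v "f u"]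
        by (simp add: o_def)
      finally have 1: "h (f v) (g v) - h (f u) (g u) =
        integral {u..v} (\<lambda>r. h (f' r) (g v)) + integral {u..v} (\<lambda>r. h (f u) (g' r))" .
      have "integral {0..u} ?d + integral {u..v} ?d = integral {0..v} ?d"
        using uv by (intro Henstock_Kurzweil_Integration.integral_combine loc_bdd_meas_integrable md) auto
      then have "D v - D u = integral {u..v} (\<lambda>r. h (f' r) (g v)) + integral {u..v} (\<lambda>r. h (f u) (g' r)) - integral {u..v} ?d"
        unfolding D_def 1[symmetric] by (simp add: algebra_simps)
      also have "\<dots> = integral {u..v} (\<lambda>r. h (f' r) (g v) + h (f u) (g' r) - ?d r)"
        by (simp add: integral_add[OF i1 i2] integral_diff[OF integrable_add[OF i1 i2] i3])
      also have "\<dots> = integral {u..v} ?e"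
        by (rule arg_cong[of _ _ "integral {u..v}"]) (auto simp: h.diff_left h.diff_right)
      finally have 2: "D v - D u = integral {u..v} ?e" .
      have "norm (integral {u..v} ?e) \<le> integral {u..v} (\<lambda>r. ?c * (v - u))"
      proof (rule integral_norm_bound_integral[OF i4])
        fix r assume r: "r \<in> {u..v}"
        have "norm (g v - g r) \<le> lg * (v - u)"
          by (intro order_trans[OF lg(2)[of r v]] mult_left_mono) (use r uv lg(1) in auto)
        then have "norm (h (f' r) (g v - g r)) \<le> bf * (lg * (v - u)) * k"
          by (intro order_trans[OF k(1)] mult_right_mono mult_mono bf(2))
            (use r uv bf(1) lg(1) k(2) in auto)
        moreover have "norm (f r - f u) \<le> lf * (v - u)"
          by (intro order_trans[OF lf(2)[of u r]] mult_left_mono) (use r uv lf(1) in auto)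
        then have "norm (h (f r - f u) (g' r)) \<le> (lf * (v - u)) * bg * k"
          by (intro order_trans[OF k(1)] mult_right_mono mult_mono bg(2))
            (use r uv bg(1) lf(1) k(2) in auto)
        ultimately show "norm (?e r) \<le> ?c * (v - u)"
          by (intro order_trans[OF norm_triangle_ineq4]) (simp add: algebra_simps)
      qed auto
      then show "norm (D v - D u) \<le> ?c * (v - u)\<^sup>2"
        unfolding 2 using uv by (simp add: power2_eq_square mult.commute mult.left_commute)
    qed
  qed
  show ?thesis unfolding primitive_def
  proof (intro conjI allI impI md)
    fix u v :: real assume uv: "0 \<le> u \<and> u \<le> v"
    have "integral {0..u} ?d + integral {u..v} ?d = integral {0..v} ?d"
      using uv by (intro Henstock_Kurzweil_Integration.integral_combine loc_bdd_meas_integrable md) auto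
    then have eq: "integral {u..v} ?d = integral {0..v} ?d - integral {0..u} ?d"
      by (simp add: eq_diff_eq add.commute)
    have "D v = D u" using D0[of u] D0[of v] uv by auto
    then show "h (f v) (g v) - h (f u) (g u) = integral {u..v} ?d"
      unfolding D_def eq by (simp add: algebra_simps)
  qed
qed

lemma primitive_zero_constant:
  assumes "primitive f (\<lambda>_. 0)" "0 \<le> s" "0 \<le> t"
  shows "f t = f s"
  using primitiveD[OF assms(1), of s t] primitiveD[OF assms(1), of t s] assms
  by (cases "s \<le> t") auto

lemma primitive_of_integral:
  assumes "loc_bdd_meas g"
  shows "primitive (\<lambda>t. integral {0..t} g) g"
  unfolding primitive_def
proof (intro conjI allI impI assms)
  fix u v :: real assume uv: "0 \<le> u \<and> u \<le> v"
  have "integral {0..u} g + integral {u..v} g = integral {0..v} g"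
    using uv by (intro Henstock_Kurzweil_Integration.integral_combine loc_bdd_meas_integrable assms) auto
  then show "integral {0..v} g - integral {0..u} g = integral {u..v} g" by (simp add: algebra_simps)
qed

lemma primitive_cong:
  assumes "primitive f g" "\<And>t. 0 \<le> t \<Longrightarrow> f t = f' t" "\<And>t. 0 \<le> t \<Longrightarrow> g t = g' t"
  shows "primitive f' g'"
  unfolding primitive_def
proof (intro conjI allI impI)
  show "loc_bdd_meas g'"
    by (rule loc_bdd_meas_cong[OF _ assms(3)]) (use assms(1) in \<open>simp_all add: primitive_def\<close>)
  fix u v :: real assume uv: "0 \<le> u \<and> u \<le> v"
  have "integral {u..v} g = integral {u..v} g'"
    by (rule integral_cong) (use assms(3) uv in auto)
  then show "f' v - f' u = integral {u..v} g'"
    using primitiveD[OF assms(1), of u v] assms(2)[of u] assms(2)[of v] uv by simp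
qed

lemma primitive_linear:
  assumes h: "bounded_linear h" and f: "primitive f g"
  shows "primitive (\<lambda>t. h (f t)) (\<lambda>t. h (g t))"
  unfolding primitive_def
proof (intro conjI allI impI)
  have g: "loc_bdd_meas g" using f unfolding primitive_def by blast
  show "loc_bdd_meas (\<lambda>t. h (g t))" by (rule loc_bdd_meas_linear[OF h g])
  fix u v :: real assume uv: "0 \<le> u \<and> u \<le> v"
  have "h (f v) - h (f u) = h (f v - f u)" using h by (simp add: linear_simps)
  also have "f v - f u = integral {u..v} g" using primitiveD[OF f] uv by auto
  also have "h (integral {u..v} g) = integral {u..v} (\<lambda>t. h (g t))"
    using integral_linear[OF loc_bdd_meas_integrable[OF g] h, of u v] uv by (simp add: o_def)
  finally show "h (f v) - h (f u) = integral {u..v} (\<lambda>t. h (g t))" .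
qed

subsection \<open>Fundamental matrices and variation of constants\<close>

primrec picard :: "(real \<Rightarrow> real^'n^'n) \<Rightarrow> nat \<Rightarrow> real \<Rightarrow> real^'n^'n" where
  "picard A 0 = (\<lambda>t. mat 1)"
| "picard A (Suc k) = (\<lambda>t. integral {0..t} (\<lambda>r. A r ** picard A k r))"

lemmas loc_bdd_meas_matrix_mult = loc_bdd_meas_bilinear[OF bounded_bilinear_matrix_mult]
lemmas loc_bdd_meas_matrix_vector_mult = loc_bdd_meas_bilinear[OF bounded_bilinear_matrix_vector_mult]

lemma loc_bdd_meas_picard:
  assumes "loc_bdd_meas A"
  shows "loc_bdd_meas (picard A k)"
proof (induction k)
  case 0 show ?case unfolding picard.simps(1) by (rule loc_bdd_meas_const)
next
  case (Suc k)
  show ?case unfolding picard.simps(2)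
    by (intro primitive_loc_bdd_meas[OF primitive_of_integral] loc_bdd_meas_matrix_mult assms Suc)
qed

lemma has_integral_monomial:
  fixes t :: real
  assumes "0 \<le> t"
  shows "((\<lambda>r. r ^ k / fact k) has_integral t ^ Suc k / fact (Suc k)) {0..t}"
proof -
  have "((\<lambda>r. r ^ k / fact k) has_integral t ^ Suc k / fact (Suc k) - 0 ^ Suc k / fact (Suc k)) {0..t}"
  proof (rule fundamental_theorem_of_calculus[OF assms])
    fix x assume "x \<in> {0..t}"
    have "((\<lambda>r. r ^ Suc k / fact (Suc k)) has_real_derivative (of_nat (Suc k) * x ^ k) / fact (Suc k)) (at x within {0..t})"
      using DERIV_cdivide[OF DERIV_pow[of "Suc k" x "{0..t}"], of "fact (Suc k)"] by simp
    moreover have "(of_nat (Suc k) * x ^ k) / fact (Suc k) = x ^ k / fact k"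
      by (simp add: fact_Suc del: of_nat_Suc)
    ultimately show "((\<lambda>r. r ^ Suc k / fact (Suc k)) has_vector_derivative x ^ k / fact k) (at x within {0..t})"
      by (simp add: has_real_derivative_iff_has_vector_derivative)
  qed
  then show ?thesis by simp
qed

text \<open>By induction, each integration turns \<open>r ^ k / fact k\<close> into the next term of
  this shape and gains a factor \<open>b\<close>, so the terms are dominated by an exponential
  series. The last conclusion, with the same \<open>b\<close>, serves the dominated convergence
  argument below.\<close>

lemma picard_bound:
  assumes A: "loc_bdd_meas A" and T: "0 \<le> T"
  obtains b where "b > 0"
    "\<And>k t. 0 \<le> t \<Longrightarrow> t \<le> T \<Longrightarrow> norm (picard A k t) \<le> norm (mat 1 :: real^'n^'n) * b ^ k * (t ^ k / fact k)"
    "\<And>r Z :: real^'n^'n. 0 \<le> r \<Longrightarrow> r \<le> T \<Longrightarrow> norm (A r ** Z) \<le> b * norm Z"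
proof -
  obtain d where d: "d > 0" "\<And>t. 0 \<le> t \<Longrightarrow> t \<le> T \<Longrightarrow> norm (A t) \<le> d"
    using loc_bdd_meas_bound[OF A T] by blast
  obtain k where k: "k > 0" "\<And>(x::real^'n^'n) (y::real^'n^'n). norm (x ** y) \<le> norm x * norm y * k"
    using bounded_bilinear.pos_bounded[OF bounded_bilinear_matrix_mult] by blast
  have b: "norm (A r ** Z) \<le> d * k * norm Z" if "0 \<le> r" "r \<le> T" for r and Z :: "real^'n^'n"
  proof -
    have "norm (A r ** Z) \<le> norm (A r) * norm Z * k" by (rule k(2))
    also have "\<dots> \<le> d * norm Z * k"
      by (intro mult_right_mono d(2)) (use that k(1) in auto)
    finally show ?thesis by (simp add: ac_simps)
  qed
  have "norm (picard A j t) \<le> norm (mat 1 :: real^'n^'n) * (d * k) ^ j * (t ^ j / fact j)"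
    if "0 \<le> t" "t \<le> T" for j t using that
  proof (induction j arbitrary: t)
    case 0 then show ?case by simp
  next
    case (Suc j)
    let ?N = "norm (mat 1 :: real^'n^'n)"
    have i: "((\<lambda>r. ?N * (d * k) ^ Suc j * (r ^ j / fact j)) has_integral
       ?N * (d * k) ^ Suc j * (t ^ Suc j / fact (Suc j))) {0..t}"
      by (rule has_integral_mult_right[OF has_integral_monomial[OF Suc.prems(1)]])
    have "norm (integral {0..t} (\<lambda>r. A r ** picard A j r)) \<le> integral {0..t} (\<lambda>r. ?N * (d * k) ^ Suc j * (r ^ j / fact j))"
    proof (rule integral_norm_bound_integral)
      show "(\<lambda>r. A r ** picard A j r) integrable_on {0..t}"
        by (intro loc_bdd_meas_integrable loc_bdd_meas_matrix_mult A loc_bdd_meas_picard) simp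
      show "(\<lambda>r. ?N * (d * k) ^ Suc j * (r ^ j / fact j)) integrable_on {0..t}"
        using i by blast
      fix r assume r: "r \<in> {0..t}"
      have "norm (A r ** picard A j r) \<le> d * k * norm (picard A j r)"
        using r Suc.prems by (intro b) auto
      also have "\<dots> \<le> d * k * (?N * (d * k) ^ j * (r ^ j / fact j))"
        using r Suc.prems d(1) k(1) by (intro mult_left_mono Suc.IH) auto
      finally show "norm (A r ** picard A j r) \<le> ?N * (d * k) ^ Suc j * (r ^ j / fact j)"
        by (simp add: ac_simps)
    qed
    then show ?case unfolding picard.simps integral_unique[OF i] .
  qed
  then show thesis using that[of "d * k"] b d(1) k(1) by simp
qed

text \<open>\<open>X\<close> is the sum of the iterated integrals \<open>picard A k\<close>. It
  converges by comparison with an exponential series on each bounded interval, and dominated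
  convergence passes the recursion of the partial sums to the integral equation.\<close>

lemma fundamental_solution_exists:
  fixes A :: "real \<Rightarrow> real^'n^'n"
  assumes A: "loc_bdd_meas A"
  obtains X :: "real \<Rightarrow> real^'n^'n" where "X 0 = mat 1" "primitive X (\<lambda>r. A r ** X r)"
proof -
  define S where "S = (\<lambda>n t. \<Sum>k<n. picard A k t)"
  define X where "X = (\<lambda>t. \<Sum>k. picard A k t)"
  have Sm: "loc_bdd_meas (S n)" for n
  proof (induction n)
    case 0 show ?case unfolding S_def by (simp add: loc_bdd_meas_const)
  next
    case (Suc n)
    show ?case using loc_bdd_meas_add[OF Suc loc_bdd_meas_picard[OF A, of n]] unfolding S_def by simp
  qed
  have lim: "\<exists>B b. B \<ge> 0 \<and> b > 0 \<and> (\<forall>t\<in>{0..T}. (\<lambda>n. S n t) \<longlonglongrightarrow> X t \<and> (\<forall>n. norm (S n t) \<le> B) \<and>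
      (\<forall>Z :: real^'n^'n. norm (A t ** Z) \<le> b * norm Z))" if T: "0 \<le> T" for T
  proof -
    obtain b where b: "b > 0"
      "\<And>k t. 0 \<le> t \<Longrightarrow> t \<le> T \<Longrightarrow> norm (picard A k t) \<le> norm (mat 1 :: real^'n^'n) * b ^ k * (t ^ k / fact k)"
      "\<And>r Z :: real^'n^'n. 0 \<le> r \<Longrightarrow> r \<le> T \<Longrightarrow> norm (A r ** Z) \<le> b * norm Z"
      using picard_bound[OF A T] by blast
    \<comment> \<open>Replacing \<open>t\<close> by the endpoint \<open>T\<close> gives one summable
      majorant for all times in \<open>{0..T}\<close>, a multiple of the series of
      \<open>exp (b * T)\<close>.\<close>
    define M where "M = (\<lambda>k. norm (mat 1 :: real^'n^'n) * (inverse (fact k) * (b * T) ^ k))"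
    have sM: "summable M" unfolding M_def by (intro summable_mult summable_exp)
    have M0: "M k \<ge> 0" for k unfolding M_def using b T by auto
    have le: "norm (picard A k t) \<le> M k" if "t \<in> {0..T}" for k t
    proof -
      have "norm (picard A k t) \<le> norm (mat 1 :: real^'n^'n) * b ^ k * (t ^ k / fact k)"
        using that by (intro b(2)) auto
      also have "\<dots> \<le> norm (mat 1 :: real^'n^'n) * b ^ k * (T ^ k / fact k)"
        using that b(1) by (intro mult_left_mono divide_right_mono power_mono) auto
      finally show ?thesis unfolding M_def by (simp add: field_simps)
    qed
    show ?thesis
    proof (intro exI conjI ballI allI)
      show "0 \<le> suminf M" by (rule suminf_nonneg[OF sM M0])
      show "b > 0" by (rule b)
      fix t assume t: "t \<in> {0..T}"
      show "(\<lambda>n. S n t) \<longlonglongrightarrow> X t"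
        unfolding S_def X_def by (rule summable_LIMSEQ, rule summable_comparison_test'[OF sM le[OF t]])
      show "norm (S n t) \<le> suminf M" for n
        unfolding S_def
        by (rule order_trans[OF sum_norm_le[OF le[OF t]] sum_le_suminf[OF sM]]) (use M0 in auto)
      show "norm (A t ** Z) \<le> b * norm Z" for Z :: "real^'n^'n" using t b(3) by auto
    qed
  qed
  have conv: "(\<lambda>n. S n t) \<longlonglongrightarrow> X t" if "0 \<le> t" for t
    using lim[OF that] that by auto
  have Xm: "loc_bdd_meas X"
    unfolding loc_bdd_meas_def
  proof (intro conjI allI impI)
    show "X \<in> borel_measurable (lebesgue_on {0..})"
      by (rule borel_measurable_LIMSEQ_metric[of S]) (use Sm conv in \<open>auto simp: loc_bdd_meas_def\<close>)
    fix T :: real assume "0 \<le> T"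
    from lim[OF this] obtain B where B: "\<forall>t\<in>{0..T}. (\<lambda>n. S n t) \<longlonglongrightarrow> X t \<and> (\<forall>n. norm (S n t) \<le> B)"
      by blast
    show "\<exists>b. \<forall>t\<in>{0..T}. norm (X t) \<le> b"
    proof (intro exI ballI)
      fix t assume "t \<in> {0..T}"
      with B have "(\<lambda>n. S n t) \<longlonglongrightarrow> X t" "\<And>n. norm (S n t) \<le> B" by auto
      then show "norm (X t) \<le> B" using LIMSEQ_le_const2[OF tendsto_norm] by blast
    qed
  qed
  \<comment> \<open>The zeroth term is the identity, and every later term is the integral of
    \<open>A\<close> times its predecessor.\<close>
  have Suc: "S (Suc n) t = mat 1 + integral {0..t} (\<lambda>r. A r ** S n r)" for n t
  proof -
    have "S (Suc n) t = mat 1 + (\<Sum>k<n. integral {0..t} (\<lambda>r. A r ** picard A k r))"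
      unfolding S_def by (simp add: sum.lessThan_Suc_shift del: sum.lessThan_Suc)
    also have "(\<Sum>k<n. integral {0..t} (\<lambda>r. A r ** picard A k r)) = integral {0..t} (\<lambda>r. \<Sum>k<n. A r ** picard A k r)"
      by (rule integral_sum[symmetric])
        (auto intro!: loc_bdd_meas_integrable loc_bdd_meas_matrix_mult A loc_bdd_meas_picard)
    finally show ?thesis unfolding S_def
      by (simp add: bounded_bilinear.sum_right[OF bounded_bilinear_matrix_mult])
  qed
  have X: "X t = mat 1 + integral {0..t} (\<lambda>r. A r ** X r)" if t: "0 \<le> t" for t
  proof -
    obtain B b where B: "B \<ge> 0" "b > 0" "\<forall>r\<in>{0..t}. (\<lambda>n. S n r) \<longlonglongrightarrow> X r \<and> (\<forall>n. norm (S n r) \<le> B) \<and>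
      (\<forall>Z :: real^'n^'n. norm (A r ** Z) \<le> b * norm Z)"
      using lim[OF t] by blast
    \<comment> \<open>The bound \<open>B\<close> on the partial sums is uniform in \<open>n\<close>
      and in time, so the constant \<open>b * B\<close> dominates all integrands.\<close>
    have "(\<lambda>n. integral {0..t} (\<lambda>r. A r ** S n r)) \<longlonglongrightarrow> integral {0..t} (\<lambda>r. A r ** X r)"
    proof (rule dominated_convergence(2))
      show "(\<lambda>r. A r ** S n r) integrable_on {0..t}" for n
        by (intro loc_bdd_meas_integrable loc_bdd_meas_matrix_mult A Sm) simp
      show "(\<lambda>_. b * B) integrable_on {0..t}" by (rule integrable_const_ivl)
      show "norm (A r ** S n r) \<le> b * B" if "r \<in> {0..t}" for n r
      proof -
        have "norm (A r ** S n r) \<le> b * norm (S n r)" "norm (S n r) \<le> B" using B that by auto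
        then show ?thesis using mult_left_mono[of "norm (S n r)" B b] B by linarith
      qed
      show "(\<lambda>n. A r ** S n r) \<longlonglongrightarrow> A r ** X r" if "r \<in> {0..t}" for r
        using B that by (intro bounded_bilinear.tendsto[OF bounded_bilinear_matrix_mult] tendsto_const) auto
    qed
    then have "(\<lambda>n. S (Suc n) t) \<longlonglongrightarrow> mat 1 + integral {0..t} (\<lambda>r. A r ** X r)"
      unfolding Suc by (intro tendsto_add tendsto_const)
    moreover have "(\<lambda>n. S (Suc n) t) \<longlonglongrightarrow> X t" by (rule LIMSEQ_Suc[OF conv[OF t]])
    ultimately show ?thesis by (rule LIMSEQ_unique[symmetric])
  qed
  have AX: "loc_bdd_meas (\<lambda>r. A r ** X r)" by (intro loc_bdd_meas_matrix_mult A Xm)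
  show thesis
  proof (rule that[of X])
    show "X 0 = mat 1" using X[of 0] by simp
    show "primitive X (\<lambda>r. A r ** X r)"
      unfolding primitive_def
    proof (intro conjI AX allI impI)
      fix u v :: real assume uv: "0 \<le> u \<and> u \<le> v"
      then have "X v - X u = integral {0..v} (\<lambda>r. A r ** X r) - integral {0..u} (\<lambda>r. A r ** X r)"
        using X[of u] X[of v] by simp
      also have "\<dots> = integral {u..v} (\<lambda>r. A r ** X r)"
        using primitiveD[OF primitive_of_integral[OF AX], of u v] uv by simp
      finally show "X v - X u = integral {u..v} (\<lambda>r. A r ** X r)" .
    qed
  qed
qed

text \<open>The inverse \<open>Y\<close> carries its own differential equation, so the product rule
  applies to products with \<open>Y\<close> and no matrix inverse has to be differentiated.\<close>

definition fundamental_pair ::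
    "(real \<Rightarrow> real^'n^'n) \<Rightarrow> (real \<Rightarrow> real^'n^'n) \<Rightarrow> (real \<Rightarrow> real^'n^'n) \<Rightarrow> bool" where
  "fundamental_pair A X Y \<longleftrightarrow>
     primitive X (\<lambda>r. A r ** X r) \<and> primitive Y (\<lambda>r. - (Y r ** A r)) \<and>
     (\<forall>t\<ge>0. Y t ** X t = mat 1 \<and> X t ** Y t = mat 1)"

text \<open>The inverse of the fundamental matrix is the transpose of the fundamental matrix of the
  adjoint system \<open>z' = - A\<^sup>T z\<close>.\<close>

lemma fundamental_pair_exists:
  fixes A :: "real \<Rightarrow> real^'n^'n"
  assumes A: "loc_bdd_meas A"
  obtains X Y where "fundamental_pair A X Y"
proof -
  obtain X where X: "X 0 = mat 1" "primitive X (\<lambda>r. A r ** X r)"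
    using fundamental_solution_exists[OF A] by blast
  have "loc_bdd_meas (\<lambda>t. - transpose (A t))"
    by (intro loc_bdd_meas_minus loc_bdd_meas_linear[OF bounded_linear_transpose] A)
  then obtain Z where Z: "Z 0 = mat 1" "primitive Z (\<lambda>r. (- transpose (A r)) ** Z r)"
    using fundamental_solution_exists by blast
  define Y where "Y = (\<lambda>t. transpose (Z t))"
  have neg: "(- M) ** N = - (M ** N)" "N ** (- M) = - (N ** M)" for M N :: "real^'n^'n"
    by (simp_all add: bounded_bilinear.minus_left[OF bounded_bilinear_matrix_mult]
        bounded_bilinear.minus_right[OF bounded_bilinear_matrix_mult])
  have Y: "primitive Y (\<lambda>r. - (Y r ** A r))"
    using primitive_linear[OF bounded_linear_transpose Z(2)]
    unfolding Y_def matrix_transpose_mul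
    by (simp add: neg linear_neg[OF bounded_linear.linear[OF bounded_linear_transpose]] transpose_transpose)
  \<comment> \<open>The product rule gives the derivative \<open>- (Y A) X + Y (A X)\<close>, which
    cancels, so \<open>Y X\<close> keeps its initial value.\<close>
  have YX: "Y t ** X t = mat 1" if "0 \<le> t" for t
  proof -
    have "primitive (\<lambda>t. Y t ** X t) (\<lambda>t. (- (Y t ** A t)) ** X t + Y t ** (A t ** X t))"
      by (rule primitive_bilinear[OF bounded_bilinear_matrix_mult Y X(2)])
    then have "primitive (\<lambda>t. Y t ** X t) (\<lambda>t. 0)" by (simp add: neg matrix_mul_assoc)
    from primitive_zero_constant[OF this, of 0 t] that X(1) Z(1)
    show ?thesis by (simp add: Y_def transpose_mat)
  qed
  have "X t ** Y t = mat 1" if "0 \<le> t" for t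
    using YX[OF that] by (simp add: matrix_left_right_inverse)
  with X(2) Y YX have "fundamental_pair A X Y" unfolding fundamental_pair_def by simp
  then show thesis by (rule that)
qed

section \<open>Caratheodory solutions, transition matrices and variation of constants\<close>

lemma lin_ode_solution_iff_primitive:
  fixes A :: "real \<Rightarrow> real^'n^'n"
  assumes A: "loc_bdd_meas A"
  shows "lin_ode_solution A x \<longleftrightarrow> primitive x (\<lambda>r. A r *v x r)"
proof
  assume "primitive x (\<lambda>r. A r *v x r)"
  then show "lin_ode_solution A x"
    unfolding primitive_def lin_ode_solution_def by (auto intro: loc_bdd_meas_absolutely_integrable)
next
  assume s: "lin_ode_solution A x"
  \<comment> \<open>A priori \<open>A r *v x r\<close> is only absolutely integrable. As an
    indefinite integral \<open>x\<close> is continuous, hence locally bounded, and then so is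
    \<open>A r *v x r\<close>.\<close>
  have "continuous_on {0..} x"
  proof (rule continuous_on_halfline)
    fix T :: real assume T: "0 < T"
    have "(\<lambda>r. A r *v x r) integrable_on {0..T}"
      using s T unfolding lin_ode_solution_def absolutely_integrable_on_def by auto
    then have "continuous_on {0..T} (\<lambda>v. x 0 + integral {0..v} (\<lambda>r. A r *v x r))"
      by (intro continuous_on_add continuous_on_const indefinite_integral_continuous_1)
    moreover have "x 0 + integral {0..v} (\<lambda>r. A r *v x r) = x v" if "v \<in> {0..T}" for v
      using s that unfolding lin_ode_solution_def by (metis add_diff_cancel_left' add_diff_eq atLeastAtMost_iff order_refl)
    ultimately show "continuous_on {0..T} x" by (rule continuous_on_eq)
  qed
  then have "loc_bdd_meas (\<lambda>r. A r *v x r)"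
    by (intro loc_bdd_meas_matrix_vector_mult A loc_bdd_meas_continuous)
  then show "primitive x (\<lambda>r. A r *v x r)"
    using s unfolding primitive_def lin_ode_solution_def by blast
qed

text \<open>The terms with \<open>A\<close> cancel in the product rule. With \<open>u = 0\<close>
  this gives uniqueness of solutions; with \<open>u\<close> the perturbation it gives the variation
  of constants formula.\<close>

lemma adjoint_times_solution:
  fixes A Y :: "real \<Rightarrow> real^'n^'n"
  assumes Y: "primitive Y (\<lambda>r. - (Y r ** A r))" and x: "primitive x (\<lambda>r. A r *v x r - u r)"
  shows "primitive (\<lambda>t. Y t *v x t) (\<lambda>t. - (Y t *v u t))"
proof -
  have "primitive (\<lambda>t. Y t *v x t) (\<lambda>t. (- (Y t ** A t)) *v x t + Y t *v (A t *v x t - u t))"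
    by (rule primitive_bilinear[OF bounded_bilinear_matrix_vector_mult Y x])
  then show ?thesis
    by (rule primitive_cong)
      (auto simp: bounded_bilinear.minus_left[OF bounded_bilinear_matrix_vector_mult]
        matrix_vector_mult_diff_distrib matrix_vector_mul_assoc)
qed

lemma transition_matrix_eq:
  fixes A X Y :: "real \<Rightarrow> real^'n^'n"
  assumes A: "loc_bdd_meas A"
    and XY: "fundamental_pair A X Y"
    and ts: "0 \<le> t" "0 \<le> s"
  shows "transition_matrix A t s = X t ** Y s"
  unfolding transition_matrix_def
proof (rule the_equality)
  have X: "primitive X (\<lambda>r. A r ** X r)" and Y: "primitive Y (\<lambda>r. - (Y r ** A r))"
    and inv: "X t ** Y t = mat 1" "X s ** Y s = mat 1"
    using XY ts unfolding fundamental_pair_def by auto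
  show "\<forall>x. lin_ode_solution A x \<longrightarrow> x t = (X t ** Y s) *v x s"
  proof (intro allI impI)
    fix x assume "lin_ode_solution A x"
    then have "primitive x (\<lambda>r. A r *v x r - 0)"
      by (simp add: lin_ode_solution_iff_primitive[OF A])
    from adjoint_times_solution[OF Y this]
    have "primitive (\<lambda>t. Y t *v x t) (\<lambda>_. 0)" by simp
    then have "Y t *v x t = Y s *v x s" by (rule primitive_zero_constant[OF _ ts(2,1)])
    then have "X t *v (Y t *v x t) = X t *v (Y s *v x s)" by simp
    then show "x t = (X t ** Y s) *v x s"
      by (simp add: matrix_vector_mul_assoc inv)
  qed
  fix Z assume Z: "\<forall>x. lin_ode_solution A x \<longrightarrow> x t = Z *v x s"
  have "Z *v v = (X t ** Y s) *v v" for v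
  proof -
    \<comment> \<open>A solution with the arbitrary value \<open>v\<close> at time \<open>s\<close>;
      testing with all of these determines the matrix.\<close>
    let ?x = "\<lambda>r. X r *v (Y s *v v)"
    have "primitive ?x (\<lambda>r. A r *v ?x r)"
      using primitive_linear[OF bounded_bilinear.bounded_linear_left[OF bounded_bilinear_matrix_vector_mult, of "Y s *v v"] X]
      by (simp add: matrix_vector_mul_assoc matrix_mul_assoc)
    then have "?x t = Z *v ?x s" using Z lin_ode_solution_iff_primitive[OF A] by blast
    then show ?thesis by (simp add: matrix_vector_mul_assoc inv flip: matrix_mul_assoc)
  qed
  then show "Z = X t ** Y s" by (simp add: matrix_eq)
qed

text \<open>The perturbed solution solves the equation of \<open>A\<close> with the inhomogeneity
  \<open>L r *v x r\<close>. Multiplying by the inverse \<open>Y\<close> of the fundamental matrix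
  leaves a pure integral; multiplying back by \<open>X s\<close> produces the kernel
  \<open>X s ** Y r\<close>, a transition matrix of \<open>A\<close>.\<close>

lemma variation_of_constants:
  fixes A L :: "real \<Rightarrow> real^'n^'n"
  assumes A: "loc_bdd_meas A" and L: "loc_bdd_meas L" and ts: "0 \<le> t" "t \<le> s"
  shows "transition_matrix (\<lambda>r. A r - L r) s t *v v = transition_matrix A s t *v v -
    integral {t..s} (\<lambda>r. transition_matrix A s r *v (L r *v (transition_matrix (\<lambda>r. A r - L r) r t *v v)))"
proof -
  obtain X Y where XY: "fundamental_pair A X Y" by (rule fundamental_pair_exists[OF A])
  then have X: "primitive Y (\<lambda>r. - (Y r ** A r))" "X s ** Y s = mat 1"
    using ts unfolding fundamental_pair_def by auto
  have AL: "loc_bdd_meas (\<lambda>r. A r - L r)" by (intro loc_bdd_meas_diff A L)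
  obtain X' Y' where XY': "fundamental_pair (\<lambda>r. A r - L r) X' Y'" by (rule fundamental_pair_exists[OF AL])
  then have X': "primitive X' (\<lambda>r. (A r - L r) ** X' r)" "X' t ** Y' t = mat 1"
    using ts unfolding fundamental_pair_def by auto
  define x where "x = (\<lambda>r. X' r *v (Y' t *v v))"
  have xe: "transition_matrix (\<lambda>r. A r - L r) r t *v v = x r" if "0 \<le> r" for r
    using that ts by (simp add: transition_matrix_eq[OF AL XY'] x_def matrix_vector_mul_assoc)
  have "primitive x (\<lambda>r. (A r - L r) *v x r)"
    using primitive_linear[OF bounded_bilinear.bounded_linear_left[OF bounded_bilinear_matrix_vector_mult, of "Y' t *v v"] X'(1)]
    unfolding x_def by (simp add: matrix_vector_mul_assoc matrix_mul_assoc)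
  then have x: "primitive x (\<lambda>r. A r *v x r - L r *v x r)"
    by (simp add: matrix_vector_mult_diff_rdistrib)
  have i: "(\<lambda>r. Y r *v (L r *v x r)) integrable_on {t..s}"
    by (intro loc_bdd_meas_integrable loc_bdd_meas_matrix_vector_mult L ts(1)
        primitive_loc_bdd_meas[OF x] primitive_loc_bdd_meas[OF X(1)])
  have "Y s *v x s - Y t *v x t = - integral {t..s} (\<lambda>r. Y r *v (L r *v x r))"
    using primitiveD[OF adjoint_times_solution[OF X(1) x] ts] by simp
  then have "Y s *v x s = Y t *v x t - integral {t..s} (\<lambda>r. Y r *v (L r *v x r))"
    by (simp add: algebra_simps)
  then have "X s *v (Y s *v x s) = X s *v (Y t *v x t) - X s *v integral {t..s} (\<lambda>r. Y r *v (L r *v x r))"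
    by (simp add: matrix_vector_mult_diff_distrib)
  moreover have "x t = v" unfolding x_def using X'(2) by (simp add: matrix_vector_mul_assoc)
  moreover have "X s *v (Y s *v x s) = x s" using X(2) by (simp add: matrix_vector_mul_assoc)
  moreover have "X s *v integral {t..s} (\<lambda>r. Y r *v (L r *v x r)) = integral {t..s} (\<lambda>r. X s *v (Y r *v (L r *v x r)))"
    using integral_linear[OF i matrix_vector_mul_bounded_linear[of "X s"]] by (simp add: o_def)
  moreover have "integral {t..s} (\<lambda>r. X s *v (Y r *v (L r *v x r))) =
     integral {t..s} (\<lambda>r. transition_matrix A s r *v (L r *v (transition_matrix (\<lambda>r. A r - L r) r t *v v)))"
    by (rule integral_cong) (use ts in \<open>auto simp: transition_matrix_eq[OF A XY] xe matrix_vector_mul_assoc matrix_mul_assoc\<close>)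
  ultimately show ?thesis using ts by (simp add: xe transition_matrix_eq[OF A XY] matrix_vector_mul_assoc)
qed

section \<open>Regularity of transition matrices and comparison of matrix norms\<close>

lemma loc_bdd_meas_fundamental_pair:
  assumes "fundamental_pair A X Y"
  shows "loc_bdd_meas X" "loc_bdd_meas Y"
  using assms primitive_loc_bdd_meas unfolding fundamental_pair_def by auto

text \<open>The first argument varies in outputs and Gramians, the second in the kernel of the
  variation of constants formula.\<close>

lemma loc_bdd_meas_transition_matrix:
  fixes A :: "real \<Rightarrow> real^'n^'n"
  assumes A: "loc_bdd_meas A" and t: "0 \<le> t"
  shows "loc_bdd_meas (\<lambda>s. transition_matrix A s t)" "loc_bdd_meas (\<lambda>s. transition_matrix A t s)"
proof -
  obtain X Y where XY: "fundamental_pair A X Y" by (rule fundamental_pair_exists[OF A])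
  have "loc_bdd_meas (\<lambda>s. X s ** Y t)" "loc_bdd_meas (\<lambda>s. X t ** Y s)"
    by (intro loc_bdd_meas_matrix_mult loc_bdd_meas_fundamental_pair[OF XY] loc_bdd_meas_const)+
  from loc_bdd_meas_cong[OF this(1)] loc_bdd_meas_cong[OF this(2)]
  show "loc_bdd_meas (\<lambda>s. transition_matrix A s t)" "loc_bdd_meas (\<lambda>s. transition_matrix A t s)"
    by (simp_all add: transition_matrix_eq[OF A XY] t)
qed

lemma norm_matrix_vector_le_op_norm: "norm (M *v x) \<le> op_norm M * norm x"
  by (rule onorm[OF matrix_vector_mul_bounded_linear])

text \<open>Every entry is bounded by the operator norm. The crude constant suffices, since it only
  serves to transfer local boundedness.\<close>

lemma norm_matrix_le_op_norm:
  fixes M :: "real^'n^'m"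
  shows "norm M \<le> real CARD('m) * real CARD('n) * op_norm M"
proof -
  have "norm M \<le> (\<Sum>i\<in>UNIV. norm (M $ i))" unfolding norm_vec_def by (rule L2_set_le_sum) simp
  also have "\<dots> \<le> (\<Sum>i\<in>(UNIV::'m set). real CARD('n) * op_norm M)"
  proof (rule sum_mono)
    fix i
    have "norm (M $ i) \<le> (\<Sum>j\<in>UNIV. \<bar>M $ i $ j\<bar>)" by (rule norm_le_l1_cart)
    also have "\<dots> \<le> (\<Sum>j\<in>(UNIV::'n set). op_norm M)" by (intro sum_mono matrix_component_le_onorm)
    finally show "norm (M $ i) \<le> real CARD('n) * op_norm M" by simp
  qed
  finally show ?thesis by simp
qed

lemma loc_bdd_meas_of_op_norm:
  fixes A :: "real \<Rightarrow> real^'n^'m"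
  assumes "meas_on_halfline A" and "locally_bounded A"
  shows "loc_bdd_meas A"
  unfolding loc_bdd_meas_def
proof (intro conjI allI impI)
  show "A \<in> borel_measurable (lebesgue_on {0..})" using assms(1) unfolding meas_on_halfline_def .
  fix T :: real assume "0 \<le> T"
  then obtain b where b: "\<forall>t\<in>{0..T}. op_norm (A t) \<le> b" using assms(2) unfolding locally_bounded_def by blast
  show "\<exists>b. \<forall>t\<in>{0..T}. norm (A t) \<le> b"
  proof (intro exI ballI)
    fix t assume "t \<in> {0..T}"
    then show "norm (A t) \<le> real CARD('m) * real CARD('n) * b"
      using b by (intro order_trans[OF norm_matrix_le_op_norm] mult_left_mono) auto
  qed
qed

subsection \<open>Gramians as output energies\<close>

lemma inner_vector_matrix_mult: "x \<bullet> (y v* M) = (M *v x) \<bullet> y" for M :: "real^'n^'m"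
  by (metis dot_lmul_matrix inner_commute)

text \<open>Transposition and \<open>M \<mapsto> v \<bullet> (M *v v)\<close> are bounded linear, so
  both claims reduce to the integrand, where moving the transposes across the inner product yields
  the squared norm of the output.\<close>

lemma
  fixes A :: "real \<Rightarrow> real^'n^'n" and C :: "real \<Rightarrow> real^'n^'m"
  assumes A: "loc_bdd_meas A" and C: "loc_bdd_meas C" and t: "0 \<le> t"
  shows transpose_obs_gramian: "transpose (obs_gramian A C t u) = obs_gramian A C t u"
    and quadratic_form_obs_gramian: "v \<bullet> (obs_gramian A C t u *v v) =
      integral {t..u} (\<lambda>s. (norm (C s *v (transition_matrix A s t *v v)))\<^sup>2)"
proof -
  let ?G = "\<lambda>s. transpose (transition_matrix A s t) ** transpose (C s) ** C s ** transition_matrix A s t"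
  have i: "?G integrable_on {t..u}"
    by (intro loc_bdd_meas_integrable loc_bdd_meas_matrix_mult C t
        loc_bdd_meas_linear[OF bounded_linear_transpose] loc_bdd_meas_transition_matrix[OF A t])
  have "transpose (integral {t..u} ?G) = integral {t..u} (\<lambda>s. transpose (?G s))"
    using integral_linear[OF i bounded_linear_transpose] by (simp add: o_def)
  then show "transpose (obs_gramian A C t u) = obs_gramian A C t u"
    unfolding obs_gramian_def by (simp add: matrix_transpose_mul transpose_transpose matrix_mul_assoc)
  have "bounded_linear (\<lambda>M. v \<bullet> (M *v v))"
    by (intro bounded_linear_inner_right_comp
        bounded_bilinear.bounded_linear_left[OF bounded_bilinear_matrix_vector_mult])
  from integral_linear[OF i this]
  have "v \<bullet> (integral {t..u} ?G *v v) = integral {t..u} (\<lambda>s. v \<bullet> (?G s *v v))" by (simp add: o_def)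
  also have "(\<lambda>s. v \<bullet> (?G s *v v)) = (\<lambda>s. (norm (C s *v (transition_matrix A s t *v v)))\<^sup>2)"
    by (rule ext) (simp add: power2_norm_eq_inner inner_vector_matrix_mult flip: matrix_vector_mul_assoc)
  finally show "v \<bullet> (obs_gramian A C t u *v v) =
      integral {t..u} (\<lambda>s. (norm (C s *v (transition_matrix A s t *v v)))\<^sup>2)"
    unfolding obs_gramian_def .
qed

section \<open>Loewner bounds as bounds on quadratic forms\<close>

lemma transpose_diff: "transpose (M - N) = transpose M - transpose N" for M N :: "real^'n^'m"
  by (simp add: vec_eq_iff transpose_def)

lemma scaleR_mat_1_mult: "(c *\<^sub>R mat 1) *v x = c *\<^sub>R x" for x :: "real^'n"
  by (simp add: scaleR_matrix_vector_assoc[symmetric])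

lemma loewner_le_scaled_identity:
  assumes "transpose M = M"
  shows "loewner_le (c *\<^sub>R mat 1) M \<longleftrightarrow> (\<forall>x. c * (x \<bullet> x) \<le> x \<bullet> (M *v x))"
    and "loewner_le M (c *\<^sub>R mat 1) \<longleftrightarrow> (\<forall>x. x \<bullet> (M *v x) \<le> c * (x \<bullet> x))"
  using assms unfolding loewner_le_def pos_semidef_def
  by (auto simp: transpose_diff transpose_scalar transpose_mat matrix_vector_mult_diff_rdistrib
      scaleR_mat_1_mult inner_diff_right)

text \<open>The exponents and the thresholds \<open>\<sigma>0\<close> are kept;
  \<open>\<theta>0\<close> is divided by \<alpha> and \<open>\<theta>1\<close> is multiplied by
  \<beta>. This works because the comparison factors depend on \<sigma> alone and not on
  \<open>t\<close>.\<close>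

lemma NUCO_transfer:
  fixes A A' :: "real \<Rightarrow> real^'n^'n" and C C' :: "real \<Rightarrow> real^'n^'m"
  assumes sym: "\<And>t u. 0 \<le> t \<Longrightarrow> transpose (obs_gramian A C t u) = obs_gramian A C t u"
      "\<And>t u. 0 \<le> t \<Longrightarrow> transpose (obs_gramian A' C' t u) = obs_gramian A' C' t u"
    and pos: "\<And>\<sigma>. 0 \<le> \<sigma> \<Longrightarrow> 0 < \<alpha> \<sigma>" "\<And>\<sigma>. 0 \<le> \<sigma> \<Longrightarrow> 0 < \<beta> \<sigma>"
    and le: "\<And>t \<sigma> v. 0 \<le> t \<Longrightarrow> 0 \<le> \<sigma> \<Longrightarrow> v \<bullet> (obs_gramian A C t (t + \<sigma>) *v v) \<le> \<alpha> \<sigma> * (v \<bullet> (obs_gramian A' C' t (t + \<sigma>) *v v))"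
      "\<And>t \<sigma> v. 0 \<le> t \<Longrightarrow> 0 \<le> \<sigma> \<Longrightarrow> v \<bullet> (obs_gramian A' C' t (t + \<sigma>) *v v) \<le> \<beta> \<sigma> * (v \<bullet> (obs_gramian A C t (t + \<sigma>) *v v))"
    and N: "NUCO A C"
  shows "NUCO A' C'"
proof -
  obtain \<nu>0 \<nu>1 and \<theta>0 \<theta>1 :: "real \<Rightarrow> real" where
    \<nu>: "\<nu>0 \<ge> 0" "\<nu>1 \<ge> 0" and \<theta>: "\<forall>\<sigma>\<ge>0. \<theta>0 \<sigma> > 0 \<and> \<theta>1 \<sigma> > 0" and
    G: "\<forall>t\<ge>0. \<exists>\<sigma>0>0. \<forall>\<sigma>\<ge>\<sigma>0.
           loewner_le ((\<theta>0 \<sigma> * exp (- 2 * \<nu>0 * t)) *\<^sub>R mat 1) (obs_gramian A C t (t + \<sigma>)) \<and>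
           loewner_le (obs_gramian A C t (t + \<sigma>)) ((\<theta>1 \<sigma> * exp (2 * \<nu>1 * t)) *\<^sub>R mat 1)"
    using N unfolding NUCO_def by blast
  have bounds: "\<exists>\<sigma>0>0. \<forall>\<sigma>\<ge>\<sigma>0.
           loewner_le ((\<theta>0 \<sigma> / \<alpha> \<sigma> * exp (- 2 * \<nu>0 * t)) *\<^sub>R mat 1) (obs_gramian A' C' t (t + \<sigma>)) \<and>
           loewner_le (obs_gramian A' C' t (t + \<sigma>)) ((\<beta> \<sigma> * \<theta>1 \<sigma> * exp (2 * \<nu>1 * t)) *\<^sub>R mat 1)"
    if t: "t \<ge> 0" for t
  proof -
    obtain \<sigma>0 where s0: "\<sigma>0 > 0" and G': "\<forall>\<sigma>\<ge>\<sigma>0.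
           loewner_le ((\<theta>0 \<sigma> * exp (- 2 * \<nu>0 * t)) *\<^sub>R mat 1) (obs_gramian A C t (t + \<sigma>)) \<and>
           loewner_le (obs_gramian A C t (t + \<sigma>)) ((\<theta>1 \<sigma> * exp (2 * \<nu>1 * t)) *\<^sub>R mat 1)"
      using G t by blast
    show ?thesis
    proof (intro exI conjI allI impI)
      show "\<sigma>0 > 0" by (rule s0)
      fix \<sigma> assume s: "\<sigma> \<ge> \<sigma>0"
      then have s': "\<sigma> \<ge> 0" using s0 by simp
      have q: "\<theta>0 \<sigma> * exp (- 2 * \<nu>0 * t) * (x \<bullet> x) \<le> x \<bullet> (obs_gramian A C t (t + \<sigma>) *v x)"
        "x \<bullet> (obs_gramian A C t (t + \<sigma>) *v x) \<le> \<theta>1 \<sigma> * exp (2 * \<nu>1 * t) * (x \<bullet> x)" for x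
        using G' s loewner_le_scaled_identity[OF sym(1)[OF t]] by blast+
      show "loewner_le ((\<theta>0 \<sigma> / \<alpha> \<sigma> * exp (- 2 * \<nu>0 * t)) *\<^sub>R mat 1) (obs_gramian A' C' t (t + \<sigma>))"
        unfolding loewner_le_scaled_identity(1)[OF sym(2)[OF t]]
      proof
        fix x :: "real^'n"
        show "\<theta>0 \<sigma> / \<alpha> \<sigma> * exp (- 2 * \<nu>0 * t) * (x \<bullet> x) \<le> x \<bullet> (obs_gramian A' C' t (t + \<sigma>) *v x)"
          using order_trans[OF q(1)[of x] le(1)[OF t s']] pos(1)[OF s']
          by (simp add: pos_divide_le_eq mult.commute)
      qed
      show "loewner_le (obs_gramian A' C' t (t + \<sigma>)) ((\<beta> \<sigma> * \<theta>1 \<sigma> * exp (2 * \<nu>1 * t)) *\<^sub>R mat 1)"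
        unfolding loewner_le_scaled_identity(2)[OF sym(2)[OF t]]
      proof
        fix x :: "real^'n"
        show "x \<bullet> (obs_gramian A' C' t (t + \<sigma>) *v x) \<le> \<beta> \<sigma> * \<theta>1 \<sigma> * exp (2 * \<nu>1 * t) * (x \<bullet> x)"
          using order_trans[OF le(2)[OF t s'] mult_left_mono[OF q(2)[of x], of "\<beta> \<sigma>"]] pos(2)[OF s']
          by (simp add: mult.assoc)
      qed
    qed
  qed
  have "\<forall>\<sigma>\<ge>0. \<theta>0 \<sigma> / \<alpha> \<sigma> > 0 \<and> \<beta> \<sigma> * \<theta>1 \<sigma> > 0" using \<theta> pos by simp
  then show ?thesis
    unfolding NUCO_def
    by (intro exI[of _ \<nu>0] exI[of _ \<nu>1] exI[of _ "\<lambda>\<sigma>. \<theta>0 \<sigma> / \<alpha> \<sigma>"] exI[of _ "\<lambda>\<sigma>. \<beta> \<sigma> * \<theta>1 \<sigma>"]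
        conjI \<nu> allI[OF impI[OF bounds]])
qed

subsection \<open>Comparison of output energies\<close>

lemma loc_bdd_meas_power2:
  fixes f :: "real \<Rightarrow> real"
  assumes "loc_bdd_meas f"
  shows "loc_bdd_meas (\<lambda>t. (f t)\<^sup>2)"
  unfolding power2_eq_square by (rule loc_bdd_meas_bilinear[OF bounded_bilinear_mult assms assms])

text \<open>Cauchy-Schwarz against the constant 1, obtained by integrating
  \<open>0 \<le> (z s - m)^2\<close> with \<open>m\<close> the mean of \<open>z\<close>. The mean
  needs an interval of positive length, hence the case distinction.\<close>

lemma square_integral_le:
  fixes z :: "real \<Rightarrow> real"
  assumes z: "loc_bdd_meas z" and t: "0 \<le> t" "0 \<le> \<sigma>"
  shows "(integral {t..t+\<sigma>} z)\<^sup>2 \<le> \<sigma> * integral {t..t+\<sigma>} (\<lambda>s. (z s)\<^sup>2)"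
proof (cases "\<sigma> = 0")
  case False
  let ?I = "integral {t..t+\<sigma>}"
  define m where "m = ?I z / \<sigma>"
  have i: "z integrable_on {t..t+\<sigma>}" "(\<lambda>s. (z s)\<^sup>2) integrable_on {t..t+\<sigma>}"
    by (intro loc_bdd_meas_integrable loc_bdd_meas_power2 z t)+
  have "?I (\<lambda>s. 2 * m * z s) \<le> ?I (\<lambda>s. (z s)\<^sup>2 + m\<^sup>2)"
  proof (rule integral_le)
    show "(\<lambda>s. 2 * m * z s) integrable_on {t..t+\<sigma>}" by (intro integrable_on_mult_right i)
    show "(\<lambda>s. (z s)\<^sup>2 + m\<^sup>2) integrable_on {t..t+\<sigma>}" by (intro integrable_add i integrable_const_ivl)
    show "2 * m * z s \<le> (z s)\<^sup>2 + m\<^sup>2" for s using sum_squares_bound[of m "z s"] by simp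
  qed
  then have "2 * m * ?I z \<le> ?I (\<lambda>s. (z s)\<^sup>2) + \<sigma> * m\<^sup>2"
    using t by (simp add: integral_add[OF i(2) integrable_const_ivl])
  then show ?thesis using False t unfolding m_def by (simp add: field_simps power2_eq_square)
qed simp

text \<open>From \<open>(x + J)^2 \<le> 2 x^2 + 2 J^2\<close>: integrating the constant
  \<open>J^2\<close> gives one factor \<sigma>, and Cauchy-Schwarz applied to the integral in
  \<open>J\<close> gives the other.\<close>

lemma integral_square_perturbation:
  fixes w z :: "real \<Rightarrow> real"
  assumes w: "loc_bdd_meas w" and z: "loc_bdd_meas z" and t: "0 \<le> t" "0 \<le> \<sigma>"
    and w0: "\<And>s. 0 \<le> w s"
    and le: "\<And>s. s \<in> {t..t+\<sigma>} \<Longrightarrow> w s \<le> z s + d * integral {t..t+\<sigma>} z"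
  shows "integral {t..t+\<sigma>} (\<lambda>s. (w s)\<^sup>2) \<le> 2 * (1 + d\<^sup>2 * \<sigma>\<^sup>2) * integral {t..t+\<sigma>} (\<lambda>s. (z s)\<^sup>2)"
proof -
  let ?I = "integral {t..t+\<sigma>}"
  define J where "J = d * ?I z"
  have i: "(\<lambda>s. (w s)\<^sup>2) integrable_on {t..t+\<sigma>}" "(\<lambda>s. (z s)\<^sup>2) integrable_on {t..t+\<sigma>}"
    by (intro loc_bdd_meas_integrable loc_bdd_meas_power2 w z t)+
  have "?I (\<lambda>s. (w s)\<^sup>2) \<le> ?I (\<lambda>s. 2 * (z s)\<^sup>2 + 2 * J\<^sup>2)"
  proof (rule integral_le[OF i(1)])
    show "(\<lambda>s. 2 * (z s)\<^sup>2 + 2 * J\<^sup>2) integrable_on {t..t+\<sigma>}"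
      by (intro integrable_add integrable_on_mult_right i integrable_const_ivl)
    fix s assume s: "s \<in> {t..t+\<sigma>}"
    have "(w s)\<^sup>2 \<le> (z s + J)\<^sup>2"
      using le[OF s] w0[of s] unfolding J_def by (intro power_mono) auto
    also have "\<dots> \<le> 2 * (z s)\<^sup>2 + 2 * J\<^sup>2"
      using sum_squares_bound[of "z s" J] by (simp add: power2_sum)
    finally show "(w s)\<^sup>2 \<le> 2 * (z s)\<^sup>2 + 2 * J\<^sup>2" .
  qed
  also have "\<dots> = 2 * ?I (\<lambda>s. (z s)\<^sup>2) + 2 * \<sigma> * J\<^sup>2"
    using t integrable_on_mult_right[OF i(2), of 2] by (simp add: integral_add[OF _ integrable_const_ivl])
  also have "2 * \<sigma> * J\<^sup>2 \<le> 2 * \<sigma> * (d\<^sup>2 * (\<sigma> * ?I (\<lambda>s. (z s)\<^sup>2)))"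
    unfolding J_def power_mult_distrib
    by (intro mult_left_mono square_integral_le z t) (use t in auto)
  finally show ?thesis by (simp add: algebra_simps power2_eq_square)
qed

text \<open>Gronwall's argument for the primitive \<open>Z\<close> of \<open>z\<close>. Integrating
  the hypothesis gives \<open>Z \<le> G\<close>. As \<open>z\<close> is merely measurable, it is
  \<open>G\<close> that is differentiated, which is possible because \<open>Z\<close> is
  continuous.\<close>

lemma integral_gronwall:
  fixes w z :: "real \<Rightarrow> real"
  assumes w: "loc_bdd_meas w" and z: "loc_bdd_meas z" and t: "0 \<le> t" "0 \<le> \<sigma>" and c: "0 \<le> c"
    and w0: "\<And>s. 0 \<le> w s"
    and le: "\<And>s. s \<in> {t..t+\<sigma>} \<Longrightarrow> z s \<le> w s + c * integral {t..s} z"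
    and s: "s \<in> {t..t+\<sigma>}"
  shows "integral {t..s} z \<le> exp (c * \<sigma>) * integral {t..t+\<sigma>} w"
proof -
  define Z where "Z = (\<lambda>s. integral {t..s} z)"
  define W where "W = integral {t..t+\<sigma>} w"
  define G where "G = (\<lambda>s. W + c * integral {t..s} Z)"
  have W0: "0 \<le> W" unfolding W_def by (intro integral_nonneg loc_bdd_meas_integrable w t w0)
  have cZ: "continuous_on {t..t+\<sigma>} Z"
    unfolding Z_def by (intro indefinite_integral_continuous_1 loc_bdd_meas_integrable z t)
  have iZ: "Z integrable_on {t..s}" if "s \<in> {t..t+\<sigma>}" for s
    by (rule integrable_continuous_real, rule continuous_on_subset[OF cZ]) (use that in auto)
  have ZG: "Z s \<le> G s" if s: "s \<in> {t..t+\<sigma>}" for s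
  proof -
    have "Z s \<le> integral {t..s} (\<lambda>r. w r + c * Z r)"
      unfolding Z_def
    proof (rule integral_le)
      show "z integrable_on {t..s}" by (intro loc_bdd_meas_integrable z t)
      show "(\<lambda>r. w r + c * integral {t..r} z) integrable_on {t..s}"
        by (intro integrable_add integrable_on_mult_right loc_bdd_meas_integrable[OF w t(1)]
            iZ[OF s, unfolded Z_def])
      show "z r \<le> w r + c * integral {t..r} z" if "r \<in> {t..s}" for r
        using le that s by auto
    qed
    also have "\<dots> = integral {t..s} w + c * integral {t..s} Z"
      using integrable_on_mult_right[OF iZ[OF s], of c]
      by (simp add: integral_add[OF loc_bdd_meas_integrable[OF w t(1)]])
    also have "integral {t..s} w \<le> W"
      unfolding W_def
      by (rule integral_subset_le) (use s w0 t in \<open>auto intro!: loc_bdd_meas_integrable w\<close>)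
    finally show ?thesis unfolding G_def by simp
  qed
  \<comment> \<open>The derivative is \<open>c * exp (- c * (x - t))\<close> times
    \<open>Z x - G x\<close>, which is not positive.\<close>
  have "(\<lambda>s. G s * exp (- c * (s - t))) s \<le> (\<lambda>s. G s * exp (- c * (s - t))) t"
  proof (rule DERIV_nonpos_imp_decreasing_open[of t s])
    show "t \<le> s" using s by simp
    show "continuous_on {t..s} (\<lambda>s. G s * exp (- c * (s - t)))"
      unfolding G_def by (intro continuous_intros indefinite_integral_continuous_1 iZ s)
    fix x assume x: "t < x" "x < s"
    have "((\<lambda>s. integral {t..s} Z) has_real_derivative Z x) (at x within {t..t+\<sigma>})"
      using integral_has_real_derivative[OF cZ] x s by auto
    moreover have "at x within {t..t+\<sigma>} = at x"
      using x s by (intro at_within_interior) (auto simp: interior_atLeastAtMost_real)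
    ultimately have "((\<lambda>s. integral {t..s} Z) has_real_derivative Z x) (at x)" by simp
    then have "((\<lambda>s. G s * exp (- c * (s - t))) has_real_derivative
        (c * Z x) * exp (- c * (x - t)) + (exp (- c * (x - t)) * (- c)) * G x) (at x)"
      unfolding G_def by (auto intro!: derivative_eq_intros)
    moreover have "(c * Z x) * exp (- c * (x - t)) + (exp (- c * (x - t)) * (- c)) * G x
        = (c * exp (- c * (x - t))) * (Z x - G x)" by (simp add: algebra_simps)
    moreover have "\<dots> \<le> 0"
      using ZG[of x] x s c by (intro mult_nonneg_nonpos) auto
    ultimately show "\<exists>y. ((\<lambda>s. G s * exp (- c * (s - t))) has_real_derivative y) (at x) \<and> y \<le> 0"
      by auto
  qed
  then have "G s * exp (- c * (s - t)) \<le> W" by (simp add: G_def)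
  moreover have "G s = exp (c * (s - t)) * (G s * exp (- c * (s - t)))"
    using exp_minus_inverse[of "c * (s - t)"] by (simp add: mult.left_commute)
  ultimately have "G s \<le> exp (c * (s - t)) * W"
    by (metis mult_left_mono exp_ge_zero)
  also have "\<dots> \<le> exp (c * \<sigma>) * W"
    using s c W0 by (intro mult_right_mono) (auto intro!: mult_left_mono)
  finally show ?thesis using ZG[OF s] unfolding Z_def W_def by simp
qed

section \<open>The Volterra inequality for the outputs and its consequences\<close>

text \<open>Since \<open>r \<le> s\<close>, the exponent \<open>- \<gamma> s + \<epsilon> r + a (s - r) + \<delta> r\<close> of the Volterra kernel is at most
  \<open>- (\<gamma> - \<epsilon> - \<delta>) s\<close>.\<close>

lemma output_perturbation:
  fixes A :: "real \<Rightarrow> real^'n^'n" and C :: "real \<Rightarrow> real^'n^'m" and K :: "real \<Rightarrow> real^'m^'n"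
  assumes A: "loc_bdd_meas A" and C: "loc_bdd_meas C" and K: "loc_bdd_meas K"
    and growth: "nonuniform_bounded_growth A K0 a \<epsilon>"
    and Kc: "\<And>z. z \<ge> 0 \<Longrightarrow> op_norm (K z) \<le> Kc * exp (\<delta> * z)"
    and Cc: "\<And>z. z \<ge> 0 \<Longrightarrow> op_norm (C z) \<le> Cc * exp (- \<gamma> * z)"
    and pos: "Kc > 0" "Cc > 0"
    and ex: "\<gamma> - (\<epsilon> + \<delta>) > 0" "- a + \<epsilon> + \<delta> > 0"
    and ts: "0 \<le> t" "t \<le> s"
  shows "norm (C s *v (transition_matrix A s t *v v) -
      C s *v (transition_matrix (\<lambda>r. A r - K r ** C r) s t *v v))
    \<le> Cc * K0 * Kc * integral {t..s} (\<lambda>r. norm (C r *v (transition_matrix (\<lambda>r. A r - K r ** C r) r t *v v)))"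
proof -
  let ?A' = "\<lambda>r. A r - K r ** C r"
  define y where "y = (\<lambda>r. C r *v (transition_matrix ?A' r t *v v))"
  have KC: "loc_bdd_meas (\<lambda>r. K r ** C r)" by (intro loc_bdd_meas_matrix_mult K C)
  have A': "loc_bdd_meas ?A'" by (intro loc_bdd_meas_diff A KC)
  have y: "loc_bdd_meas y"
    unfolding y_def
    by (intro loc_bdd_meas_matrix_vector_mult C loc_bdd_meas_transition_matrix[OF A' ts(1)] loc_bdd_meas_const)
  have K0: "K0 > 0" using growth unfolding nonuniform_bounded_growth_def by blast
  have s: "0 \<le> s" using ts by simp
  let ?f = "\<lambda>r. transition_matrix A s r *v (K r *v y r)"
  have fm: "loc_bdd_meas ?f"
    by (intro loc_bdd_meas_matrix_vector_mult K y loc_bdd_meas_transition_matrix[OF A s])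
  \<comment> \<open>Grouping \<open>C r\<close> with the perturbed solution makes the integrand
    depend on that solution only through its output \<open>y r\<close>.\<close>
  have "transition_matrix A s t *v v - transition_matrix ?A' s t *v v = integral {t..s} ?f"
    using variation_of_constants[OF A KC ts, of v]
    by (simp add: y_def matrix_vector_mul_assoc matrix_mul_assoc)
  then have "C s *v (transition_matrix A s t *v v) - C s *v (transition_matrix ?A' s t *v v) = C s *v integral {t..s} ?f"
    by (simp add: matrix_vector_mult_diff_distrib[symmetric])
  also have "\<dots> = integral {t..s} (\<lambda>r. C s *v ?f r)"
    using integral_linear[OF loc_bdd_meas_integrable[OF fm ts(1)] matrix_vector_mul_bounded_linear[of "C s"]]
    by (simp add: o_def)
  also have "norm \<dots> \<le> integral {t..s} (\<lambda>r. Cc * K0 * Kc * norm (y r))"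
  proof (rule integral_norm_bound_integral)
    show "(\<lambda>r. C s *v ?f r) integrable_on {t..s}"
      by (intro loc_bdd_meas_integrable loc_bdd_meas_matrix_vector_mult loc_bdd_meas_const fm ts(1))
    show "(\<lambda>r. Cc * K0 * Kc * norm (y r)) integrable_on {t..s}"
      by (intro integrable_on_mult_right loc_bdd_meas_integrable loc_bdd_meas_norm y ts(1))
    fix r assume r: "r \<in> {t..s}"
    then have r0: "0 \<le> r" "r \<le> s" using ts by auto
    have "norm (K r *v y r) \<le> Kc * exp (\<delta> * r) * norm (y r)"
      by (intro order_trans[OF norm_matrix_vector_le_op_norm] mult_right_mono Kc r0) simp
    moreover have "op_norm (transition_matrix A s r) \<le> K0 * exp (\<epsilon> * r) * exp (a * (s - r))"
      using growth r0 s unfolding nonuniform_bounded_growth_def by (metis abs_of_nonneg diff_ge_0_iff_ge)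
    ultimately have "norm (?f r) \<le> K0 * exp (\<epsilon> * r) * exp (a * (s - r)) * (Kc * exp (\<delta> * r) * norm (y r))"
      by - (rule order_trans[OF norm_matrix_vector_le_op_norm mult_mono], use K0 in auto)
    then have "norm (C s *v ?f r) \<le> Cc * exp (- \<gamma> * s) * (K0 * exp (\<epsilon> * r) * exp (a * (s - r)) * (Kc * exp (\<delta> * r) * norm (y r)))"
      using pos Cc[OF s] by - (rule order_trans[OF norm_matrix_vector_le_op_norm mult_mono], auto)
    also have "\<dots> = Cc * K0 * Kc * norm (y r) * exp (- \<gamma> * s + \<epsilon> * r + a * (s - r) + \<delta> * r)"
      by (simp only: exp_add mult_ac)
    also have "\<dots> \<le> Cc * K0 * Kc * norm (y r) * 1"
    proof (rule mult_left_mono)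
      \<comment> \<open>The first inequality replaces \<open>r\<close> by \<open>s\<close> and uses
        \<open>- a + \<epsilon> + \<delta> > 0\<close>; the second is the decay left over from
        \<open>\<gamma> > \<epsilon> + \<delta>\<close>.\<close>
      have "(\<epsilon> + \<delta> - a) * r \<le> (\<epsilon> + \<delta> - a) * s" "0 \<le> (\<gamma> - (\<epsilon> + \<delta>)) * s"
        using r0 s ex by (auto intro!: mult_left_mono mult_nonneg_nonneg)
      then show "exp (- \<gamma> * s + \<epsilon> * r + a * (s - r) + \<delta> * r) \<le> 1" by (simp add: algebra_simps)
    qed (use pos K0 in auto)
    finally show "norm (C s *v ?f r) \<le> Cc * K0 * Kc * norm (y r)" by simp
  qed
  finally show ?thesis by (simp add: y_def)
qed

text \<open>Growth is assumed for \<open>A\<close> only, so the kernel belongs to \<open>A\<close>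
  and the integral contains \<open>z\<close>. Hence \<open>w\<close> is bounded by \<open>z\<close>
  directly, whereas the bound of \<open>z\<close> by \<open>w\<close> is implicit and costs the
  Gronwall factor \<open>exp (c * \<sigma>)\<close>.\<close>

lemma observed_energy_comparison:
  fixes w z :: "real \<Rightarrow> real"
  assumes w: "loc_bdd_meas w" and z: "loc_bdd_meas z" and t: "0 \<le> t" "0 \<le> \<sigma>" and c: "0 \<le> c"
    and w0: "\<And>s. 0 \<le> w s" and z0: "\<And>s. 0 \<le> z s"
    and le: "\<And>s. s \<in> {t..t+\<sigma>} \<Longrightarrow> \<bar>w s - z s\<bar> \<le> c * integral {t..s} z"
  shows "integral {t..t+\<sigma>} (\<lambda>s. (w s)\<^sup>2) \<le> 2 * (1 + c\<^sup>2 * \<sigma>\<^sup>2) * integral {t..t+\<sigma>} (\<lambda>s. (z s)\<^sup>2)"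
    and "integral {t..t+\<sigma>} (\<lambda>s. (z s)\<^sup>2) \<le> 2 * (1 + (c * exp (c * \<sigma>))\<^sup>2 * \<sigma>\<^sup>2) * integral {t..t+\<sigma>} (\<lambda>s. (w s)\<^sup>2)"
proof -
  show "integral {t..t+\<sigma>} (\<lambda>s. (w s)\<^sup>2) \<le> 2 * (1 + c\<^sup>2 * \<sigma>\<^sup>2) * integral {t..t+\<sigma>} (\<lambda>s. (z s)\<^sup>2)"
  proof (rule integral_square_perturbation[OF w z t w0])
    fix s assume s: "s \<in> {t..t+\<sigma>}"
    have "integral {t..s} z \<le> integral {t..t+\<sigma>} z"
      by (rule integral_subset_le) (use s z0 t in \<open>auto intro!: loc_bdd_meas_integrable z\<close>)
    then have "c * integral {t..s} z \<le> c * integral {t..t+\<sigma>} z" using c by (rule mult_left_mono)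
    then show "w s \<le> z s + c * integral {t..t+\<sigma>} z" using le[OF s] by linarith
  qed
  show "integral {t..t+\<sigma>} (\<lambda>s. (z s)\<^sup>2) \<le> 2 * (1 + (c * exp (c * \<sigma>))\<^sup>2 * \<sigma>\<^sup>2) * integral {t..t+\<sigma>} (\<lambda>s. (w s)\<^sup>2)"
  proof (rule integral_square_perturbation[OF z w t z0])
    fix s assume s: "s \<in> {t..t+\<sigma>}"
    have le': "z r \<le> w r + c * integral {t..r} z" if "r \<in> {t..t+\<sigma>}" for r
      using le[OF that] by linarith
    have "c * integral {t..s} z \<le> c * (exp (c * \<sigma>) * integral {t..t+\<sigma>} w)"
      by (intro mult_left_mono c integral_gronwall[OF w z t c w0 le' s])
    then show "z s \<le> w s + c * exp (c * \<sigma>) * integral {t..t+\<sigma>} w"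
      using le'[OF s] by (simp add: mult.assoc)
  qed
qed

theorem theorem4p1:
  fixes A :: "real \<Rightarrow> real^'n^'n"
    and B :: "real \<Rightarrow> real^'p^'n"
    and C :: "real \<Rightarrow> real^'n^'m"
    and F :: "real \<Rightarrow> real^'m^'p"
    and K :: "real \<Rightarrow> real^'m^'n"
    and K0 a \<epsilon> Kc Cc \<delta> \<gamma> :: real
  assumes "meas_on_halfline A" and "locally_bounded A"
    and "meas_on_halfline B" and "locally_bounded B"
    and "meas_on_halfline C" and "locally_bounded C"
    and "meas_on_halfline F"
    and "\<And>t. t \<ge> 0 \<Longrightarrow> K t = B t ** F t"
    and "K0 > 0" and "a > 0" and "\<epsilon> > 0"
    and "nonuniform_bounded_growth A K0 a \<epsilon>"
    and "Kc > 0" and "Cc > 0" and "\<delta> > 0" and "\<gamma> > 0"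
    and "\<And>z. z \<ge> 0 \<Longrightarrow> op_norm (K z) \<le> Kc * exp (\<delta> * z)"
    and "\<And>z. z \<ge> 0 \<Longrightarrow> op_norm (C z) \<le> Cc * exp (- \<gamma> * z)"
    and "\<gamma> - (\<epsilon> + \<delta>) > 0"
    and "- a + \<epsilon> + \<delta> > 0"
  shows "NUCO A C \<longleftrightarrow> NUCO (\<lambda>t. A t - K t ** C t) C"
proof -
  let ?A' = "\<lambda>t. A t - K t ** C t"
  have A: "loc_bdd_meas A" and C: "loc_bdd_meas C"
    using assms(1,2,5,6) loc_bdd_meas_of_op_norm by auto
  \<comment> \<open>The factorisation supplies the measurability of \<open>K\<close>. As
    \<open>F\<close> may be unbounded, local boundedness of \<open>K\<close> is taken from its
    exponential bound instead.\<close>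
  have "(\<lambda>t. B t ** F t) \<in> borel_measurable (lebesgue_on {0..})"
  proof (rule borel_measurable_continuous_Pair[where H = "(**)"])
    show "continuous_on UNIV (\<lambda>x. fst x ** snd x :: real^'m^'n)"
      by (intro bounded_bilinear.continuous_on[OF bounded_bilinear_matrix_mult]
          continuous_on_fst continuous_on_snd continuous_on_id)
  qed (use assms(3,7) in \<open>auto simp: meas_on_halfline_def\<close>)
  moreover have "K \<in> borel_measurable (lebesgue_on {0..}) \<longleftrightarrow>
      (\<lambda>t. B t ** F t) \<in> borel_measurable (lebesgue_on {0..})"
    by (rule measurable_cong) (use assms(8) in auto)
  ultimately have mK: "meas_on_halfline K" unfolding meas_on_halfline_def by simp
  have "locally_bounded K" unfolding locally_bounded_def
  proof (intro allI impI exI ballI)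
    fix T t :: real assume "0 \<le> T" "t \<in> {0..T}"
    then show "op_norm (K t) \<le> Kc * exp (\<delta> * T)"
      using assms(13,15) by (intro order_trans[OF assms(17)] mult_left_mono) auto
  qed
  with mK have K: "loc_bdd_meas K" by (rule loc_bdd_meas_of_op_norm)
  have A': "loc_bdd_meas ?A'" by (intro loc_bdd_meas_diff loc_bdd_meas_matrix_mult A K C)
  \<comment> \<open>The bound of the Volterra kernel. It is independent of \<open>t\<close>, so the
    factors \<alpha> and \<beta> built from it depend on \<sigma> only.\<close>
  define c where "c = Cc * K0 * Kc"
  have c: "0 \<le> c" using assms(9,13,14) unfolding c_def by simp
  define \<alpha> where "\<alpha> = (\<lambda>\<sigma>. 2 * (1 + c\<^sup>2 * \<sigma>\<^sup>2))"
  define \<beta> where "\<beta> = (\<lambda>\<sigma>. 2 * (1 + (c * exp (c * \<sigma>))\<^sup>2 * \<sigma>\<^sup>2))"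
  have pos: "0 < \<alpha> \<sigma>" "0 < \<beta> \<sigma>" for \<sigma>
    unfolding \<alpha>_def \<beta>_def by (auto intro!: add_pos_nonneg)
  note sym = transpose_obs_gramian[OF A C] transpose_obs_gramian[OF A' C]
  have le: "v \<bullet> (obs_gramian A C t (t + \<sigma>) *v v) \<le> \<alpha> \<sigma> * (v \<bullet> (obs_gramian ?A' C t (t + \<sigma>) *v v))"
      "v \<bullet> (obs_gramian ?A' C t (t + \<sigma>) *v v) \<le> \<beta> \<sigma> * (v \<bullet> (obs_gramian A C t (t + \<sigma>) *v v))"
    if t: "0 \<le> t" "0 \<le> \<sigma>" for t \<sigma> v
  proof -
    define w where "w = (\<lambda>s. norm (C s *v (transition_matrix A s t *v v)))"
    define z where "z = (\<lambda>s. norm (C s *v (transition_matrix ?A' s t *v v)))"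
    have m: "loc_bdd_meas w" "loc_bdd_meas z"
      unfolding w_def z_def
      by (intro loc_bdd_meas_norm loc_bdd_meas_matrix_vector_mult C loc_bdd_meas_const
          loc_bdd_meas_transition_matrix[OF A t(1)] loc_bdd_meas_transition_matrix[OF A' t(1)])+
    \<comment> \<open>The reverse triangle inequality passes from the difference of the output
      vectors to the difference of their norms.\<close>
    have d: "\<bar>w s - z s\<bar> \<le> c * integral {t..s} z" if "s \<in> {t..t+\<sigma>}" for s
      unfolding w_def z_def c_def
      by (rule order_trans[OF norm_triangle_ineq3 output_perturbation[OF A C K assms(12,17,18,13,14,19,20)]])
        (use t that in auto)
    have nn: "0 \<le> w s" "0 \<le> z s" for s unfolding w_def z_def by auto
    show "v \<bullet> (obs_gramian A C t (t + \<sigma>) *v v) \<le> \<alpha> \<sigma> * (v \<bullet> (obs_gramian ?A' C t (t + \<sigma>) *v v))"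
      "v \<bullet> (obs_gramian ?A' C t (t + \<sigma>) *v v) \<le> \<beta> \<sigma> * (v \<bullet> (obs_gramian A C t (t + \<sigma>) *v v))"
      using observed_energy_comparison[OF m t c nn d]
      unfolding quadratic_form_obs_gramian[OF A C t(1)] quadratic_form_obs_gramian[OF A' C t(1)]
        w_def z_def \<alpha>_def \<beta>_def by auto
  qed
  show ?thesis
  proof
    assume "NUCO A C"
    then show "NUCO ?A' C"
      by (rule NUCO_transfer[OF sym pos le, rotated -1])
  next
    \<comment> \<open>The hypotheses of \<open>NUCO_transfer\<close> are symmetric under exchanging
      the two systems together with \<alpha> and \<beta>, so the same two inequalities in the other
      order give the converse.\<close>
    assume "NUCO ?A' C"
    then show "NUCO A C"
      by (rule NUCO_transfer[OF sym(2,1) pos(2,1) le(2,1), rotated -1])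
  qed
qed

end
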